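(* Suppose that $W\in\mathbb{R}^{n\times n}$ is a symmetric positive semidefinite (SPSD) matrix, $r$, $K$ and $n$ are three positive integers such that $r<K<n$, $\epsilon$ is a positive number, and $\mathcal I\subset[n]$ is the output of the Main Algorithm (described in the context) applied to $W$ with parameters $K$, $r$, $\epsilon$. Write $C:=W_{:,\mathcal I}$, $U:=(W_{\mathcal I,\mathcal I})_r^{+}$, and $R:=W_{\mathcal I,:}$. Then $$\|W-CUR\|_C\le(1+\epsilon)\frac{K+1}{K-r+1}\,\sigma_{r+1}(W).$$ In particular, let $K=cr-1$ for $c>1$. Then $$\|W-CUR\|_C\le\Big(1+\frac1{c-1}\Big)(1+\epsilon)\,\sigma_{r+1}(W).$$ Furthermore, the Main Algorithm runs at an arithmetic cost in $O((r+\log n)\,rK^4n\,\epsilon^{-1})$ as $\epsilon\to0$.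
   Context: Notation: $[n]=\{1,\dots,n\}$. For index sets $\mathcal I,\mathcal J\subset[n]$, $W_{\mathcal I,\mathcal J}$ is the submatrix of $W$ with rows in $\mathcal I$ and columns in $\mathcal J$; $W_{:,\mathcal I}$ and $W_{\mathcal I,:}$ consist of the full columns, respectively rows, indexed by $\mathcal I$. $\sigma_j(M)$ is the $j$th largest singular value of $M$ (equal to $0$ for $j>\operatorname{rank}(M)$). $M_r$ is the rank-$r$ truncation of $M$, obtained from its SVD by setting to $0$ all singular values except the $r$ largest ones, and $M_r^+$ is the Moore–Penrose pseudoinverse of $M_r$. $\|M\|_C=\max_{i,j}|m_{ij}|$ is the Chebyshev norm. For a $k\times l$ matrix $M$ and $1\le r\le\min\{k,l\}$, the $r$-projective volume is $v_{2,r}(M)=\prod_{j=1}^r\sigma_j(M)$. GECP (Gaussian elimination with complete pivoting for SPSD matrices), input an SPSD matrix $A\in\mathbb R^{n\times n}$ and a positive integer $K<n$: set $R\leftarrow A$, $\mathcal I\leftarrow\emptyset$; for $t=1,\dots,K$ choose $i_t\in\arg\max_{j\in[n]}|R_{j,j}|$, set $\mathcal I\leftarrow\mathcal I\cup\{i_t\}$ and $R\leftarrow R-R_{:,i_t}R_{i_t,i_t}^{-1}R_{i_t,:}$; return $\mathcal I$. Index Update, input an SPSD matrix $A\in\mathbb R^{n\times n}$, a set $\mathcal I\subset[n]$, a positive integer $r\le|\mathcal I|$, and $\epsilon>0$: run over all $i\in\mathcal I$ and all $j\in[n]\setminus\mathcal I$; for $\mathcal J=(\mathcal I\setminus\{i\})\cup\{j\}$,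 if $v_{2,r}(A_{\mathcal J,\mathcal J})/v_{2,r}(A_{\mathcal I,\mathcal I})>1+\epsilon$, then return $\mathcal J$ and stop. If no such pair is found, return $\mathcal I$. Main Algorithm, input an SPSD matrix $A\in\mathbb R^{n\times n}$, integers $0<r\le K<n$, and $\epsilon>0$: set $\mathcal I$ to the output of GECP$(A,K)$; repeatedly compute $\mathcal J=$ Index Update$(A,\mathcal I,r,\epsilon)$ and replace $\mathcal I$ by $\mathcal J$, until $\mathcal J=\mathcal I$; return $\mathcal I$. In the cost estimate GECP is counted at $O(nK^2)$ operations, and the $r$-projective volumes in Index Update are computed by using SVD, so that one call of Index Update is counted at $O(K^4n)$ operations. *)

theory Defs
  imports
    Complex_Main
    "Jordan_Normal_Form.Char_Poly"
    "Jordan_Normal_Form.DL_Submatrix"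
begin

(* Matrices are those of Jordan_Normal_Form, whose indices start at 0: the index set [n] is {..<n},
   and submatrix M UNIV I, submatrix M I UNIV are the full columns and rows indexed by I. *)

definition spsd :: "nat \<Rightarrow> real mat \<Rightarrow> bool" where
  "spsd n A \<longleftrightarrow> A \<in> carrier_mat n n \<and> transpose_mat A = A \<and>
     (\<forall>x \<in> carrier_vec n. 0 \<le> x \<bullet> (A *\<^sub>v x))"

definition orthogonal_matrix :: "nat \<Rightarrow> real mat \<Rightarrow> bool" where
  "orthogonal_matrix n P \<longleftrightarrow> P \<in> carrier_mat n n \<and> transpose_mat P * P = 1\<^sub>m n"

definition chebyshev_norm :: "real mat \<Rightarrow> real" where
  "chebyshev_norm M = Max (abs ` elements_mat M)"

(* Square roots of the eigenvalues of M^T M, with multiplicity, in nonincreasing order. *)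
definition singular_values :: "real mat \<Rightarrow> real list" where
  "singular_values M =
     rev (sorted_list_of_multiset (image_mset sqrt (proots (char_poly (transpose_mat M * M)))))"

(* The j-th largest singular value, counted from j = 1. *)
definition sigma :: "nat \<Rightarrow> real mat \<Rightarrow> real" where
  "sigma j M =
     (if 1 \<le> j \<and> j \<le> length (singular_values M) then singular_values M ! (j - 1) else 0)"

definition proj_volume :: "nat \<Rightarrow> real mat \<Rightarrow> real" where
  "proj_volume r M = (\<Prod>j = 1..r. sigma j M)"

definition sigma_mat :: "nat \<Rightarrow> real mat \<Rightarrow> real mat" where
  "sigma_mat r M =
     mat (dim_row M) (dim_col M) (\<lambda>(i, j). if i = j \<and> i < r then sigma (i + 1) M else 0)"

(* A relation, because for sigma r M = sigma (r + 1) M the truncation depends on the chosen SVD. *)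
definition rank_truncation :: "nat \<Rightarrow> real mat \<Rightarrow> real mat \<Rightarrow> bool" where
  "rank_truncation r M T \<longleftrightarrow>
     (\<exists>P Q. orthogonal_matrix (dim_row M) P \<and> orthogonal_matrix (dim_col M) Q \<and>
        M = P * sigma_mat (dim_row M) M * transpose_mat Q \<and>
        T = P * sigma_mat r M * transpose_mat Q)"

definition is_pinv :: "real mat \<Rightarrow> real mat \<Rightarrow> bool" where
  "is_pinv M X \<longleftrightarrow> X \<in> carrier_mat (dim_col M) (dim_row M) \<and>
     M * X * M = M \<and> X * M * X = X \<and>
     transpose_mat (M * X) = M * X \<and> transpose_mat (X * M) = X * M"

definition pinv :: "real mat \<Rightarrow> real mat" where
  "pinv M = (THE X. is_pinv M X)"

(* gecp A t I R: after t elimination steps the selected indices may be I, with residual R; ties in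
   the arg max are broken arbitrarily.  If the pivot is nonzero, then i \<notin> I holds automatically, as
   the rows of R indexed by I vanish.  If A has rank < t, the residual becomes 0 and its pivot has
   no inverse; the steps that follow then pick arbitrary new indices and (by inverse 0 = 0) leave
   R = 0, so that GECP always returns t indices. *)
inductive gecp :: "real mat \<Rightarrow> nat \<Rightarrow> nat set \<Rightarrow> real mat \<Rightarrow> bool" for A where
  start: "gecp A 0 {} A"
| step: "gecp A t I R \<Longrightarrow> i < dim_row A \<Longrightarrow> i \<notin> I \<Longrightarrow>
    (\<forall>j < dim_row A. \<bar>R $$ (j, j)\<bar> \<le> \<bar>R $$ (i, i)\<bar>) \<Longrightarrow>
    gecp A (Suc t) (insert i I)
      (mat (dim_row A) (dim_col A)
         (\<lambda>(a, b). R $$ (a, b) - R $$ (a, i) * inverse (R $$ (i, i)) * R $$ (i, b)))"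

(* If the r-projective volume for I is 0, so is that of every principal submatrix of A when I comes
   from GECP, and the quotient 0 / 0 = 0 triggers no update. *)
definition improving_swap ::
    "real mat \<Rightarrow> nat set \<Rightarrow> nat \<Rightarrow> real \<Rightarrow> nat set \<Rightarrow> bool" where
  "improving_swap A I r \<epsilon> J \<longleftrightarrow>
     (\<exists>i \<in> I. \<exists>j \<in> {..<dim_row A} - I. J = insert j (I - {i}) \<and>
        proj_volume r (submatrix A J J) / proj_volume r (submatrix A I I) > 1 + \<epsilon>)"

(* The order in which the pairs (i, j) are scanned is left open. *)
definition index_update ::
    "real mat \<Rightarrow> nat set \<Rightarrow> nat \<Rightarrow> real \<Rightarrow> nat set \<Rightarrow> bool" where
  "index_update A I r \<epsilon> J \<longleftrightarrow>
     improving_swap A I r \<epsilon> J \<or> (\<not> (\<exists>J'. improving_swap A I r \<epsilon> J') \<and> J = I)"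

(* main_run A K r \<epsilon> m I stopped: some execution holds I after m calls of Index Update; the flag
   tells whether the loop has been left (the last call returned its input). *)
inductive main_run ::
    "real mat \<Rightarrow> nat \<Rightarrow> nat \<Rightarrow> real \<Rightarrow> nat \<Rightarrow> nat set \<Rightarrow> bool \<Rightarrow> bool" for A K r \<epsilon> where
  init: "gecp A K I R \<Longrightarrow> main_run A K r \<epsilon> 0 I False"
| update: "main_run A K r \<epsilon> m I False \<Longrightarrow> index_update A I r \<epsilon> J \<Longrightarrow>
    main_run A K r \<epsilon> (Suc m) J (J = I)"

definition main_output :: "real mat \<Rightarrow> nat \<Rightarrow> nat \<Rightarrow> real \<Rightarrow> nat set \<Rightarrow> bool" where
  "main_output A K r \<epsilon> I \<longleftrightarrow> (\<exists>m. main_run A K r \<epsilon> m I True)"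

(* Operation counts of GECP (from n, K) and of one call of Index Update (from n, K, r). *)
definition gecp_counted :: "(nat \<Rightarrow> nat \<Rightarrow> nat) \<Rightarrow> bool" where
  "gecp_counted gc \<longleftrightarrow>
     (\<exists>c. \<forall>n K. 0 < K \<and> K < n \<longrightarrow> real (gc n K) \<le> c * (real n * real K ^ 2))"

definition update_counted :: "(nat \<Rightarrow> nat \<Rightarrow> nat \<Rightarrow> nat) \<Rightarrow> bool" where
  "update_counted uc \<longleftrightarrow>
     (\<exists>c. \<forall>n K r. 0 < r \<and> r \<le> K \<and> K < n \<longrightarrow> real (uc n K r) \<le> c * (real K ^ 4 * real n))"

(* Cost of an execution with m calls of Index Update. *)
definition main_cost ::
    "(nat \<Rightarrow> nat \<Rightarrow> nat) \<Rightarrow> (nat \<Rightarrow> nat \<Rightarrow> nat \<Rightarrow> nat) \<Rightarrow> nat \<Rightarrow> nat \<Rightarrow> nat \<Rightarrow> nat \<Rightarrow> nat" where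
  "main_cost gc uc n K r m = gc n K + m * uc n K r"

(* The cost bound is uniform in n, K, r and A, and it covers unfinished executions as well: for
   uc n K r = K^4 * n it bounds their number of calls, and as an unfinished execution can always be
   continued, the algorithm terminates. *)
definition main_cost_bound ::
    "(nat \<Rightarrow> nat \<Rightarrow> nat) \<Rightarrow> (nat \<Rightarrow> nat \<Rightarrow> nat \<Rightarrow> nat) \<Rightarrow> (nat \<Rightarrow> nat \<Rightarrow> nat \<Rightarrow> real \<Rightarrow> real) \<Rightarrow> bool" where
  "main_cost_bound gc uc B \<longleftrightarrow>
     (\<exists>C. \<forall>\<^sub>F \<epsilon> in at_right 0. \<forall>n K r A m I stopped.
        0 < r \<and> r < K \<and> K < n \<and> spsd n A \<and> main_run A K r \<epsilon> m I stopped \<longrightarrow>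
        real (main_cost gc uc n K r m) \<le> C * B n K r \<epsilon>)"

end

theory Submission
  imports Defs
begin

text \<open>Since \<open>W - CUR\<close> is positive semidefinite, its largest entry is a diagonal one. For \<open>j \<in> I\<close> this entry
  is at most \<open>\<sigma>\<^sub>r\<^sub>+\<^sub>1(W\<^sub>I\<^sub>I)\<close>. For \<open>j \<notin> I\<close> put \<open>M = W\<^sub>J\<^sub>J\<close> with \<open>J = I \<union> {j}\<close>: the entry times the volume of
  \<open>W\<^sub>I\<^sub>I\<close> is the determinant of a compression of \<open>M\<close>, hence at most \<open>\<sigma>\<^sub>1(M) \<cdots> \<sigma>\<^sub>r\<^sub>+\<^sub>1(M)\<close>. By
  Cauchy--Binet, deleting row and column \<open>i\<close> of \<open>M\<close> leaves a volume of at least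
  \<open>(1 - |v\<^sub>i|\<^sup>2) \<sigma>\<^sub>1(M) \<cdots> \<sigma>\<^sub>r(M)\<close>, where \<open>v\<^sub>i\<close> is the \<open>i\<close>-th row of the matrix of the \<open>r\<close> leading
  eigenvectors; as the numbers \<open>1 - |v\<^sub>i|\<^sup>2\<close> add up to \<open>K + 1 - r\<close> and no swap improves the volume by
  more than \<open>1 + \<epsilon>\<close>, averaging over \<open>i\<close> gives the factor \<open>(1 + \<epsilon>) (K + 1) / (K + 1 - r)\<close>.

  Every successful update multiplies the volume by more than \<open>1 + \<epsilon>\<close>. The pivots of complete
  pivoting satisfy \<open>\<sigma>\<^sub>t(W) \<le> n p\<^sub>t\<close>, so the initial volume is within a factor \<open>n\<^sup>r\<close> of the maximum and
  there are at most \<open>r ln n / ln (1 + \<epsilon>)\<close> successful updates.\<close>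

subsection \<open>Determinants of Gram matrices\<close>

text \<open>Write v(I) for the volume of W_II. The error at j is at most v(M) \<sigma>_{r+1}(M) /
  v(I); the averaged swaps compare v(M) with v(I), and interlacing replaces \<sigma>_{r+1}(M) by
  \<sigma>_{r+1}(W). The average runs over all K + 1 indices of M, since deleting j itself gives
  back I.

  The obstacle is v(I) = 0, where neither the quotient nor the failure of all swaps carries
  information. No update leaves volume 0 (division by zero yields 0) and none leads to it, so I is
  then still the output of GECP. Complete pivoting loses only a power of n in the volumes of every
  order, so W has some rank q < r and the volume of order q of W_II is positive; the first estimate,
  applied at order q, makes the error at most 0.

  The determinant inequalities rest on one identity: the determinant of a weighted Gram matrix is a
  sum of squared minors times products of weights, so only the weights have to be compared.\<close>

lemma bij_betw_PiE_comp_permutes: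
  assumes "p permutes S"
  shows "bij_betw (\<lambda>f. restrict (f \<circ> p) S) (S \<rightarrow>\<^sub>E I) (S \<rightarrow>\<^sub>E I)"
proof (rule bij_betwI[where g = "\<lambda>f. restrict (f \<circ> Hilbert_Choice.inv p) S"])
  have q: "Hilbert_Choice.inv p permutes S" using assms by (rule permutes_inv)
  show "(\<lambda>f. restrict (f \<circ> p) S) \<in> (S \<rightarrow>\<^sub>E I) \<rightarrow> (S \<rightarrow>\<^sub>E I)"
    using permutes_in_image[OF assms] by (auto simp: PiE_iff)
  show "(\<lambda>f. restrict (f \<circ> Hilbert_Choice.inv p) S) \<in> (S \<rightarrow>\<^sub>E I) \<rightarrow> (S \<rightarrow>\<^sub>E I)"
    using permutes_in_image[OF q] by (auto simp: PiE_iff)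
  fix f assume f: "f \<in> S \<rightarrow>\<^sub>E I"
  show "restrict (restrict (f \<circ> p) S \<circ> Hilbert_Choice.inv p) S = f"
  proof
    fix x show "restrict (restrict (f \<circ> p) S \<circ> Hilbert_Choice.inv p) S x = f x"
      using f permutes_in_image[OF q, of x] permutes_inverses[OF assms]
      by (auto simp: PiE_iff extensional_def)
  qed
  show "restrict (restrict (f \<circ> Hilbert_Choice.inv p) S \<circ> p) S = f"
  proof
    fix x show "restrict (restrict (f \<circ> Hilbert_Choice.inv p) S \<circ> p) S x = f x"
      using f permutes_in_image[OF assms, of x] permutes_inverses[OF assms]
      by (auto simp: PiE_iff extensional_def)
  qed
qed

text \<open>The map \<open>f\<close> may repeat rows or list them in any order: this is a maximal
  minor of \<open>X\<close> up to sign, or 0 if \<open>f\<close> is not injective.\<close>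

definition row_minor :: "nat \<Rightarrow> ('a \<Rightarrow> nat \<Rightarrow> real) \<Rightarrow> (nat \<Rightarrow> 'a) \<Rightarrow> real" where
  "row_minor r X f = det (mat r r (\<lambda>(i, j). X (f i) j))"

lemma row_minor_permute:
  assumes "p permutes {0..<r}"
  shows "row_minor r X (restrict (f \<circ> p) {0..<r}) = signof p * row_minor r X f"
proof -
  have "row_minor r X (restrict (f \<circ> p) {0..<r})
      = det (mat r r (\<lambda>(i, j). mat r r (\<lambda>(i, j). X (f i) j) $$ (p i, j)))"
    unfolding row_minor_def
    using permutes_in_image[OF assms] by (intro arg_cong[where f = det] eq_matI) auto
  then show ?thesis using det_permute_rows[OF _ assms, of "mat r r (\<lambda>(i, j). X (f i) j)"]
    by (simp add: row_minor_def)
qed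

text \<open>The Cauchy--Binet formula, summed over all maps instead of over the subsets of size \<open>r\<close>:
  each subset is then counted \<open>r!\<close> times, and no ordering of the index set is needed.\<close>

lemma cauchy_binet_maps:
  fixes X Y :: "'a \<Rightarrow> nat \<Rightarrow> real"
  assumes "finite I"
  shows "fact r * det (mat r r (\<lambda>(i, j). \<Sum>a\<in>I. X a i * Y a j))
    = (\<Sum>f\<in>{0..<r} \<rightarrow>\<^sub>E I. row_minor r X f * row_minor r Y f)"
proof -
  let ?S = "{0..<r}" and ?P = "{p. p permutes {0..<r}}"
  let ?D = "det (mat r r (\<lambda>(i, j). \<Sum>a\<in>I. X a i * Y a j))"
  have "?D = (\<Sum>p\<in>?P. signof p * (\<Prod>i\<in>?S. \<Sum>a\<in>I. X a i * Y a (p i)))"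
    by (subst det_def'[of _ r])
      (auto intro!: sum.cong prod.cong simp: permutes_in_image)
  also have "\<dots> = (\<Sum>p\<in>?P. \<Sum>f\<in>?S \<rightarrow>\<^sub>E I. signof p * (\<Prod>i\<in>?S. X (f i) i * Y (f i) (p i)))"
    using assms by (simp add: prod_sum_PiE sum_distrib_left)
  also have "\<dots> = (\<Sum>f\<in>?S \<rightarrow>\<^sub>E I. (\<Prod>i\<in>?S. X (f i) i) * row_minor r Y f)"
    unfolding row_minor_def
    by (subst sum.swap, intro sum.cong refl, subst det_def'[of _ r])
      (auto intro!: sum.cong prod.cong simp: permutes_in_image sum_distrib_left prod.distrib)
  finally have D: "?D = (\<Sum>f\<in>?S \<rightarrow>\<^sub>E I. (\<Prod>i\<in>?S. X (f i) i) * row_minor r Y f)" .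
  \<comment> \<open>Reindexing by \<open>f \<circ> p\<close> changes the minor of \<open>Y\<close>
    by \<open>signof p\<close> only. Summed over all \<open>p\<close>, the products of entries of
    \<open>X\<close> become the Leibniz expansion of the minor of \<open>X\<close>.\<close>
  have Dp: "?D = (\<Sum>f\<in>?S \<rightarrow>\<^sub>E I. signof p * (\<Prod>i\<in>?S. X (f (p i)) i) * row_minor r Y f)"
    if p: "p permutes ?S" for p
    unfolding D by (subst sum.reindex_bij_betw[OF bij_betw_PiE_comp_permutes[OF p], symmetric])
      (simp add: row_minor_permute[OF p] mult_ac)
  have "fact r * ?D = (\<Sum>p\<in>?P. ?D)"
    by (simp add: card_permutations)
  also have "\<dots> = (\<Sum>p\<in>?P. \<Sum>f\<in>?S \<rightarrow>\<^sub>E I. signof p * (\<Prod>i\<in>?S. X (f (p i)) i) * row_minor r Y f)"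
    by (intro sum.cong refl Dp) simp
  also have "\<dots> = (\<Sum>f\<in>?S \<rightarrow>\<^sub>E I. row_minor r X f * row_minor r Y f)"
  proof (subst sum.swap, intro sum.cong refl)
    fix f
    have "row_minor r X f = (\<Sum>p\<in>?P. signof p * (\<Prod>i\<in>?S. X (f (p i)) i))"
      unfolding row_minor_def
      by (subst det_col[of _ r])
        (auto intro!: sum.cong prod.cong simp: permutes_in_image atLeast0LessThan)
    then show "(\<Sum>p\<in>?P. signof p * (\<Prod>i\<in>?S. X (f (p i)) i) * row_minor r Y f)
        = row_minor r X f * row_minor r Y f"
      by (simp add: sum_distrib_right)
  qed
  finally show ?thesis .
qed

lemma row_minor_not_inj:
  assumes "\<not> inj_on f {0..<r}"
  shows "row_minor r X f = 0"
proof -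
  obtain i j where "i < r" "j < r" "i \<noteq> j" "f i = f j" using assms by (auto simp: inj_on_def)
  then show ?thesis unfolding row_minor_def by (intro det_identical_rows[of _ r i j]) auto
qed

lemma row_minor_scale:
  "row_minor r (\<lambda>a j. d a * X a j) f = (\<Prod>i<r. d (f i)) * row_minor r X f"
proof -
  have "row_minor r (\<lambda>a j. d a * X a j) f
      = (\<Sum>p | p permutes {0..<r}. signof p * (\<Prod>i<r. d (f i) * X (f i) (p i)))"
    unfolding row_minor_def
    by (subst det_def'[of _ r])
      (auto intro!: sum.cong prod.cong simp: permutes_in_image atLeast0LessThan)
  also have "\<dots> = (\<Prod>i<r. d (f i)) * (\<Sum>p | p permutes {0..<r}. signof p * (\<Prod>i<r. X (f i) (p i)))"
    by (simp add: prod.distrib sum_distrib_left mult.left_commute)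
  also have "(\<Sum>p | p permutes {0..<r}. signof p * (\<Prod>i<r. X (f i) (p i))) = row_minor r X f"
    unfolding row_minor_def
    by (subst det_def'[of _ r])
      (auto intro!: sum.cong prod.cong simp: permutes_in_image atLeast0LessThan)
  finally show ?thesis .
qed

section \<open>Bounds for weighted Gram determinants\<close>

text \<open>Attached to one of the two factors of Cauchy--Binet, the weights leave the minor as a
  product, and what remains is a square. The bounds below compare the coefficients of these
  squares.\<close>

lemma fact_mult_det_weighted_gram:
  fixes X :: "'a \<Rightarrow> nat \<Rightarrow> real"
  assumes "finite I"
  shows "fact r * det (mat r r (\<lambda>(i, j). \<Sum>a\<in>I. d a * X a i * X a j))
    = (\<Sum>f\<in>{0..<r} \<rightarrow>\<^sub>E I. (\<Prod>i<r. d (f i)) * (row_minor r X f)\<^sup>2)"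
  unfolding cauchy_binet_maps[OF assms, of r "\<lambda>a i. d a * X a i" X] row_minor_scale
  by (simp only: power2_eq_square mult.assoc)

lemma det_gram_nonneg:
  fixes X :: "'a \<Rightarrow> nat \<Rightarrow> real"
  assumes "finite I"
  shows "0 \<le> det (mat r r (\<lambda>(i, j). \<Sum>a\<in>I. X a i * X a j))"
proof -
  have "0 \<le> fact r * det (mat r r (\<lambda>(i, j). \<Sum>a\<in>I. X a i * X a j))"
    using fact_mult_det_weighted_gram[OF assms, of r "\<lambda>_. 1" X] by (simp add: sum_nonneg)
  moreover have "0 < (fact r :: real)" by (rule fact_gt_zero)
  ultimately show ?thesis by (meson mult_pos_neg not_le)
qed

text \<open>Induction removes the largest index of \<open>S\<close>: it is at least
  \<open>card S - 1\<close>, so its value is at most the last factor on the right.\<close>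

lemma prod_antimono_le_initial:
  fixes l :: "nat \<Rightarrow> real"
  assumes "\<And>k q. k \<le> q \<Longrightarrow> q < n \<Longrightarrow> l q \<le> l k" "\<And>k. k < n \<Longrightarrow> 0 \<le> l k"
    and "finite S" "S \<subseteq> {..<n}"
  shows "(\<Prod>k\<in>S. l k) \<le> (\<Prod>k<card S. l k)"
  using assms(3,4)
proof (induction "card S" arbitrary: S)
  case (Suc m)
  then have S: "S \<noteq> {}" "finite S" by auto
  let ?M = "Max S"
  have M: "?M \<in> S" using S by simp
  have c: "card (S - {?M}) = m" using Suc M by simp
  have "S \<subseteq> {..?M}" using S by auto
  then have "Suc m \<le> Suc ?M" using Suc(2) card_mono[of "{..?M}" S] by simp
  moreover have "?M < n" using M Suc by auto
  ultimately have "l ?M \<le> l m" using assms(1) by simp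
  moreover have "(\<Prod>k\<in>S - {?M}. l k) \<le> (\<Prod>k<m. l k)"
    using Suc(1)[of "S - {?M}"] c Suc(3,4) by auto
  moreover have "0 \<le> l ?M" using assms(2) \<open>?M < n\<close> by simp
  moreover have "0 \<le> (\<Prod>k<m. l k)" using \<open>?M < n\<close> \<open>Suc m \<le> Suc ?M\<close> by (intro prod_nonneg) (auto intro: assms(2))
  ultimately have "l ?M * (\<Prod>k\<in>S - {?M}. l k) \<le> l m * (\<Prod>k<m. l k)"
    using Suc(4) by (intro mult_mono prod_nonneg) (auto intro: assms(2))
  then show ?case using Suc(2)[symmetric] prod.remove[OF S(2) M, of l] by (simp add: mult.commute)
qed auto

text \<open>Termwise comparison: a map that is not injective has minor 0, and an injective one
  carries the weights of \<open>r\<close> distinct indices, whose product is largest for the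
  \<open>r\<close> leading ones.\<close>

lemma det_weighted_gram_le:
  fixes X :: "nat \<Rightarrow> nat \<Rightarrow> real"
  assumes mono: "\<And>k q. k \<le> q \<Longrightarrow> q < n \<Longrightarrow> l q \<le> l k" and nonneg: "\<And>k. k < n \<Longrightarrow> 0 \<le> l k"
  shows "det (mat r r (\<lambda>(i, j). \<Sum>k<n. l k * X k i * X k j))
    \<le> (\<Prod>k<r. l k) * det (mat r r (\<lambda>(i, j). \<Sum>k<n. X k i * X k j))"
proof -
  have *: "(\<Prod>i<r. l (f i)) * (row_minor r X f)\<^sup>2 \<le> (\<Prod>k<r. l k) * (row_minor r X f)\<^sup>2"
    if f: "f \<in> {0..<r} \<rightarrow>\<^sub>E {..<n}" for f
  proof (cases "inj_on f {0..<r}")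
    case True
    have "(\<Prod>i<r. l (f i)) = (\<Prod>k\<in>f ` {0..<r}. l k)"
      using True by (simp add: prod.reindex atLeast0LessThan)
    also have "\<dots> \<le> (\<Prod>k<card (f ` {0..<r}). l k)"
      using f by (intro prod_antimono_le_initial[OF mono nonneg]) auto
    also have "card (f ` {0..<r}) = r" using card_image[OF True] by simp
    finally show ?thesis by (intro mult_right_mono) auto
  next
    case False
    show ?thesis using row_minor_not_inj[OF False] by simp
  qed
  have "fact r * det (mat r r (\<lambda>(i, j). \<Sum>k<n. l k * X k i * X k j))
      \<le> (\<Sum>f\<in>{0..<r} \<rightarrow>\<^sub>E {..<n}. (\<Prod>k<r. l k) * (row_minor r X f)\<^sup>2)"
    by (subst fact_mult_det_weighted_gram) (auto intro!: sum_mono *)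
  also have "\<dots> = (\<Prod>k<r. l k) * (fact r * det (mat r r (\<lambda>(i, j). \<Sum>k<n. X k i * X k j)))"
    using fact_mult_det_weighted_gram[of "{..<n}" r "\<lambda>_. 1" X] by (simp add: sum_distrib_left)
  finally have "fact r * det (mat r r (\<lambda>(i, j). \<Sum>k<n. l k * X k i * X k j))
      \<le> fact r * ((\<Prod>k<r. l k) * det (mat r r (\<lambda>(i, j). \<Sum>k<n. X k i * X k j)))"
    by (simp add: mult.left_commute)
  then show ?thesis by (simp del: fact_Suc)
qed

text \<open>All terms of the Cauchy--Binet sum are nonnegative. Only the \<open>r!\<close> orderings
  of the leading \<open>r\<close> rows are kept; they contribute equally, since the sign of the
  minor is squared away.\<close>

lemma det_weighted_gram_ge:
  fixes X :: "nat \<Rightarrow> nat \<Rightarrow> real"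
  assumes nonneg: "\<And>k. k < n \<Longrightarrow> 0 \<le> l k" and "r \<le> n"
  shows "(\<Prod>k<r. l k) * (row_minor r X id)\<^sup>2
    \<le> det (mat r r (\<lambda>(i, j). \<Sum>k<n. l k * X k i * X k j))"
proof -
  let ?S = "{0..<r}" and ?P = "{p. p permutes {0..<r}}"
  let ?g = "\<lambda>f. (\<Prod>i<r. l (f i)) * (row_minor r X f)\<^sup>2"
  let ?t = "\<lambda>p. restrict (id \<circ> p) {0..<r}"
  have g: "?g (?t p) = (\<Prod>k<r. l k) * (row_minor r X id)\<^sup>2" if p: "p permutes ?S" for p
  proof -
    have "(\<Prod>i<r. l (?t p i)) = (\<Prod>i\<in>?S. l (p i))"
      by (intro prod.cong) auto
    also have "\<dots> = (\<Prod>k<r. l k)"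
      using prod.permute[OF p, of l] by (simp add: o_def atLeast0LessThan)
    finally show ?thesis using row_minor_permute[OF p, of X id] by (simp add: power_mult_distrib sign_def)
  qed
  have inj: "inj_on ?t ?P"
  proof (rule inj_onI)
    fix p q assume "p \<in> ?P" "q \<in> ?P" and eq: "?t p = ?t q"
    then have pq: "p permutes ?S" "q permutes ?S" by auto
    show "p = q"
    proof
      fix x show "p x = q x"
        using fun_cong[OF eq, of x] pq by (cases "x \<in> ?S") (auto simp: permutes_def)
    qed
  qed
  have "fact r * ((\<Prod>k<r. l k) * (row_minor r X id)\<^sup>2) = (\<Sum>p\<in>?P. ?g (?t p))"
    using g by (simp add: card_permutations)
  also have "\<dots> = (\<Sum>f\<in>?t ` ?P. ?g f)" using inj by (simp add: sum.reindex)
  also have "\<dots> \<le> (\<Sum>f\<in>?S \<rightarrow>\<^sub>E {..<n}. ?g f)"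
  proof (rule sum_mono2)
    show "?t ` ?P \<subseteq> ?S \<rightarrow>\<^sub>E {..<n}"
    proof (rule image_subsetI)
      fix p assume "p \<in> ?P"
      then have "p i < r" if "i < r" for i using that permutes_in_image[of p ?S i] by simp
      then show "?t p \<in> ?S \<rightarrow>\<^sub>E {..<n}"
        using assms(2) by (fastforce simp: restrict_PiE_iff)
    qed
    show "0 \<le> ?g f" if "f \<in> (?S \<rightarrow>\<^sub>E {..<n}) - ?t ` ?P" for f
    proof -
      have "f i < n" if "i < r" for i using \<open>f \<in> _\<close> that by (auto simp: PiE_iff)
      then show ?thesis by (intro mult_nonneg_nonneg prod_nonneg) (auto intro: nonneg)
    qed
  qed (simp add: finite_PiE)
  also have "\<dots> = fact r * det (mat r r (\<lambda>(i, j). \<Sum>k<n. l k * X k i * X k j))"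
    by (simp add: fact_mult_det_weighted_gram)
  finally show ?thesis by (simp del: fact_Suc)
qed

text \<open>Sylvester's determinant identity: multiplying the bordered matrix \<open>?M\<close> by
  the unit triangular \<open>?T\<close> from the right or from the left gives block lower triangular
  matrices, one with the block \<open>?G\<close>, the other with the scalar.\<close>

lemma det_one_minus_outer_product:
  fixes v :: "nat \<Rightarrow> real"
  shows "det (mat r r (\<lambda>(i, j). (if i = j then 1 else 0) - v i * v j)) = 1 - (\<Sum>i<r. (v i)\<^sup>2)"
proof -
  let ?V = "mat r 1 (\<lambda>(i, j). v i)" and ?W = "mat 1 r (\<lambda>(i, j). v j)"
  let ?T = "four_block_mat (1\<^sub>m 1) (- ?W) (0\<^sub>m r 1) (1\<^sub>m r)"
  let ?M = "four_block_mat (1\<^sub>m 1) ?W ?V (1\<^sub>m r)"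
  let ?G = "mat r r (\<lambda>(i, j). (if i = j then 1 else 0) - v i * v j)"
  have T: "det ?T = 1" by (subst det_four_block_mat_lower_left_zero[of _ 1 _ r]) auto
  have M: "?M \<in> carrier_mat (1 + r) (1 + r)" and Tc: "?T \<in> carrier_mat (1 + r) (1 + r)" by auto
  have VW: "?V * (- ?W) + 1\<^sub>m r = ?G"
    by (intro eq_matI) (auto simp: scalar_prod_def)
  have "?M * ?T = four_block_mat (1\<^sub>m 1 * 1\<^sub>m 1 + ?W * 0\<^sub>m r 1) (1\<^sub>m 1 * (- ?W) + ?W * 1\<^sub>m r)
      (?V * 1\<^sub>m 1 + 1\<^sub>m r * 0\<^sub>m r 1) (?V * (- ?W) + 1\<^sub>m r * 1\<^sub>m r)"
    by (rule mult_four_block_mat) auto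
  also have "\<dots> = four_block_mat (1\<^sub>m 1) (0\<^sub>m 1 r) ?V ?G"
    using VW by (intro cong_four_block_mat) (auto intro!: eq_matI)
  finally have "det (?M * ?T) = det ?G"
    by (simp add: det_four_block_mat_upper_right_zero[of _ 1 _ r])
  then have 1: "det ?M = det ?G" using det_mult[OF M Tc] T by simp
  have WV: "1\<^sub>m 1 + (- ?W) * ?V = mat 1 1 (\<lambda>_. 1 - (\<Sum>i<r. (v i)\<^sup>2))"
    by (intro eq_matI) (auto simp: scalar_prod_def sum_negf power2_eq_square atLeast0LessThan)
  have "?T * ?M = four_block_mat (1\<^sub>m 1 * 1\<^sub>m 1 + (- ?W) * ?V) (1\<^sub>m 1 * ?W + (- ?W) * 1\<^sub>m r)
      (0\<^sub>m r 1 * 1\<^sub>m 1 + 1\<^sub>m r * ?V) (0\<^sub>m r 1 * ?W + 1\<^sub>m r * 1\<^sub>m r)"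
    by (rule mult_four_block_mat) auto
  also have "\<dots> = four_block_mat (mat 1 1 (\<lambda>_. 1 - (\<Sum>i<r. (v i)\<^sup>2))) (0\<^sub>m 1 r) ?V (1\<^sub>m r)"
    using WV by (intro cong_four_block_mat) (auto intro!: eq_matI)
  finally have "det (?T * ?M) = 1 - (\<Sum>i<r. (v i)\<^sup>2)"
    by (simp add: det_four_block_mat_upper_right_zero[of _ 1 _ r] det_single)
  then show ?thesis using det_mult[OF Tc M] T 1 by simp
qed

subsection \<open>Diagonalization of symmetric matrices\<close>

text \<open>A complex eigenpair exists because the characteristic polynomial splits. Symmetry makes
  the Hermitian form at \<open>w\<close>, hence the eigenvalue, real; then real and imaginary part
  of \<open>w\<close> both satisfy the equation, and one of them is nonzero.\<close>

lemma symmetric_real_eigenvector: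
  fixes A :: "real mat"
  assumes A: "A \<in> carrier_mat n n" "A\<^sup>T = A" and n: "0 < n"
  obtains e v where "v \<in> carrier_vec n" "v \<bullet> v = 1" "A *\<^sub>v v = e \<cdot>\<^sub>v v"
proof -
  let ?A = "map_mat complex_of_real A"
  have A': "?A \<in> carrier_mat n n" using A by simp
  have sym: "A $$ (i, j) = A $$ (j, i)" if "i < n" "j < n" for i j
    using A that by (metis carrier_matD index_transpose_mat(1))
  obtain es where es: "char_poly ?A = (\<Prod>a\<leftarrow>es. [:- a, 1:])" "length es = n"
    using char_poly_factorized[OF A'] by blast
  then obtain c where "c \<in> set es" using n by (cases es) auto
  then have "poly (char_poly ?A) c = 0" unfolding es(1) by (simp add: poly_prod_list prod_list_zero_iff)
  then have "eigenvalue ?A c" using eigenvalue_root_char_poly[OF A'] by simp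
  then obtain w where w: "w \<in> carrier_vec n" "w \<noteq> 0\<^sub>v n" "?A *\<^sub>v w = c \<cdot>\<^sub>v w"
    unfolding eigenvalue_def eigenvector_def using A by auto
  have ev: "(\<Sum>j<n. complex_of_real (A $$ (i, j)) * w $ j) = c * w $ i" if "i < n" for i
  proof -
    have "(?A *\<^sub>v w) $ i = (\<Sum>j<n. complex_of_real (A $$ (i, j)) * w $ j)"
      using A w(1) that by (simp add: scalar_prod_def atLeast0LessThan)
    then show ?thesis using w that by simp
  qed
  let ?N = "\<Sum>i<n. (cmod (w $ i))\<^sup>2"
  let ?S = "\<Sum>i<n. \<Sum>j<n. cnj (w $ i) * (complex_of_real (A $$ (i, j)) * w $ j)"
  have "?S = (\<Sum>i<n. c * of_real ((cmod (w $ i))\<^sup>2))"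
  proof (intro sum.cong refl)
    fix i assume "i \<in> {..<n}"
    then have "(\<Sum>j<n. cnj (w $ i) * (complex_of_real (A $$ (i, j)) * w $ j)) = cnj (w $ i) * (c * w $ i)"
      by (simp only: sum_distrib_left[symmetric] ev lessThan_iff)
    then show "(\<Sum>j<n. cnj (w $ i) * (complex_of_real (A $$ (i, j)) * w $ j)) = c * of_real ((cmod (w $ i))\<^sup>2)"
      by (simp only: complex_norm_square mult_ac)
  qed
  then have S: "?S = c * of_real ?N" by (simp add: sum_distrib_left)
  have "cnj ?S = (\<Sum>i<n. \<Sum>j<n. cnj (w $ j) * (complex_of_real (A $$ (j, i)) * w $ i))"
    using sym by (auto intro!: sum.cong simp: mult_ac)
  also have "\<dots> = ?S" by (rule sum.swap)
  finally have "cnj c * of_real ?N = c * of_real ?N" unfolding S by simp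
  moreover have "?N \<noteq> 0"
  proof
    assume "?N = 0"
    then have "\<forall>i<n. w $ i = 0" by (simp add: sum_nonneg_eq_0_iff)
    then show False using w(1,2) by (metis eq_vecI carrier_vecD index_zero_vec)
  qed
  ultimately have "cnj c = c" by (metis mult_cancel_right of_real_eq_0_iff)
  then have c: "c = of_real (Re c)" by (metis Reals_cnj_iff of_real_Re)
  have re: "(\<Sum>j<n. A $$ (i, j) * Re (w $ j)) = Re c * Re (w $ i)" if "i < n" for i
    using arg_cong[OF ev[OF that], of Re] arg_cong[OF c, of Im] by (simp add: Re_sum)
  have im: "(\<Sum>j<n. A $$ (i, j) * Im (w $ j)) = Re c * Im (w $ i)" if "i < n" for i
    using arg_cong[OF ev[OF that], of Im] arg_cong[OF c, of Im] by (simp add: Im_sum)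
  obtain x where x: "\<And>i. i < n \<Longrightarrow> (\<Sum>j<n. A $$ (i, j) * x j) = Re c * x i"
    and x0: "(\<Sum>i<n. (x i)\<^sup>2) \<noteq> 0"
  proof (cases "(\<Sum>i<n. (Re (w $ i))\<^sup>2) = 0")
    case True
    then have "?N = (\<Sum>i<n. (Im (w $ i))\<^sup>2)" by (simp add: cmod_power2 sum.distrib)
    then show ?thesis using im \<open>?N \<noteq> 0\<close> by (intro that[of "\<lambda>i. Im (w $ i)"]) auto
  next
    case False
    then show ?thesis using re by (intro that[of "\<lambda>i. Re (w $ i)"]) auto
  qed
  let ?q = "sqrt (\<Sum>i<n. (x i)\<^sup>2)"
  have q: "?q * ?q = (\<Sum>i<n. (x i)\<^sup>2)" by (simp add: sum_nonneg)
  show ?thesis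
  proof (rule that[of "vec n (\<lambda>i. x i / ?q)" "Re c"])
    have "vec n (\<lambda>i. x i / ?q) \<bullet> vec n (\<lambda>i. x i / ?q) = (\<Sum>i<n. (x i)\<^sup>2) / (?q * ?q)"
      by (simp add: scalar_prod_def atLeast0LessThan sum_divide_distrib power2_eq_square
          del: real_sqrt_mult_self)
    then show "vec n (\<lambda>i. x i / ?q) \<bullet> vec n (\<lambda>i. x i / ?q) = 1" using x0 q by simp
    show "A *\<^sub>v vec n (\<lambda>i. x i / ?q) = Re c \<cdot>\<^sub>v vec n (\<lambda>i. x i / ?q)"
      using A x by (intro eq_vecI)
        (auto simp: scalar_prod_def atLeast0LessThan sum_divide_distrib[symmetric])
  qed simp
qed

lemma orthogonal_matrix_transpose_right:
  assumes "orthogonal_matrix n P"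
  shows "P * P\<^sup>T = 1\<^sub>m n"
  using assms mat_mult_left_right_inverse[of "P\<^sup>T" n P] unfolding orthogonal_matrix_def by simp

text \<open>The Householder reflection along \<open>v - e\<^sub>0\<close>; for \<open>v = e\<^sub>0\<close> the division by zero makes it the
  identity.\<close>

lemma orthogonal_matrix_first_column:
  fixes v :: "real vec"
  assumes v: "v \<in> carrier_vec n" "v \<bullet> v = 1"
  obtains H where "orthogonal_matrix n H" "H\<^sup>T = H" "col H 0 = v"
proof -
  have n: "0 < n" using v by (cases n) (auto simp: scalar_prod_def)
  define w where "w i = v $ i - (if i = 0 then 1 else 0)" for i
  define s where "s = (\<Sum>i<n. (w i)\<^sup>2)"
  define c where "c = 2 / s"
  define H where "H = mat n n (\<lambda>(i, j). (if i = j then 1 else 0) - c * w i * w j)"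
  have vv: "(\<Sum>i<n. (v $ i)\<^sup>2) = 1"
    using v by (simp add: scalar_prod_def atLeast0LessThan power2_eq_square)
  \<comment> \<open>As \<open>v\<close> is a unit vector, |v - e_0|^2 = 2 - 2 v_0. This relation
    between \<open>s\<close> and \<open>w 0\<close> makes the reflection send e_0 to
    \<open>v\<close>.\<close>
  have "s = (\<Sum>i<n. (v $ i)\<^sup>2 - 2 * (if i = 0 then v $ i else 0) + (if i = 0 then 1 else 0))"
    unfolding s_def w_def by (intro sum.cong refl) (simp add: power2_eq_square algebra_simps)
  also have "\<dots> = 2 - 2 * v $ 0"
    using n vv by (simp add: sum.distrib sum_subtractf sum_distrib_left[symmetric])
  finally have s: "s = - 2 * w 0" by (simp add: w_def)
  have w0: "w i = 0" if "s = 0" "i < n" for i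
    using that unfolding s_def by (simp add: sum_nonneg_eq_0_iff)
  have sym: "H\<^sup>T = H" unfolding H_def by (intro eq_matI) auto
  have carr: "H \<in> carrier_mat n n" by (simp add: H_def)
  have "H * H = 1\<^sub>m n"
  proof (rule eq_matI)
    fix i j assume "i < dim_row (1\<^sub>m n :: real mat)" "j < dim_col (1\<^sub>m n :: real mat)"
    then have ij: "i < n" "j < n" by auto
    have "(H * H) $$ (i, j) = (\<Sum>k<n. ((if i = k then 1 else 0) - c * w i * w k)
        * ((if k = j then 1 else 0) - c * w k * w j))"
      using ij by (simp add: H_def scalar_prod_def atLeast0LessThan)
    also have "\<dots> = (\<Sum>k<n. (if k = i then if k = j then 1 else 0 else 0)
        - (if k = i then c * w k * w j else 0) - (if k = j then c * w i * w k else 0)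
        + c * w i * (c * w j) * (w k)\<^sup>2)"
      by (intro sum.cong refl) (auto simp: power2_eq_square algebra_simps)
    also have "\<dots> = (if i = j then 1 else 0) - 2 * c * w i * w j + c * w i * (c * w j) * s"
      using ij by (simp add: sum.distrib sum_subtractf sum_distrib_left[symmetric] s_def)
    also have "\<dots> = (if i = j then 1 else 0)"
      using w0 ij by (cases "s = 0") (auto simp: c_def)
    finally show "(H * H) $$ (i, j) = (1\<^sub>m n) $$ (i, j)" using ij by simp
  qed (auto simp: H_def)
  then have "orthogonal_matrix n H" using carr sym by (simp add: orthogonal_matrix_def)
  moreover have "col H 0 = v"
  proof (rule eq_vecI)
    fix i assume "i < dim_vec v"
    then have i: "i < n" using v by simp
    have "c * w i * w 0 = - w i"
      using s w0 i n by (cases "s = 0") (auto simp: c_def)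
    then show "col H 0 $ i = v $ i" using i n by (auto simp: H_def w_def)
  qed (use v in \<open>auto simp: H_def\<close>)
  ultimately show ?thesis using sym that by blast
qed

lemma transpose_mult3:
  assumes "A \<in> carrier_mat n n" "B \<in> carrier_mat n n" "C \<in> carrier_mat n n"
  shows "(A * B * C)\<^sup>T = C\<^sup>T * (B\<^sup>T * (A :: real mat)\<^sup>T)"
  using assms by (subst transpose_mult[of _ n n _ n]) (auto intro!: arg_cong[where f = "\<lambda>X. C\<^sup>T * X"] transpose_mult)

lemma transpose_mat_diag: "(mat_diag n d)\<^sup>T = mat_diag n d"
  by (intro eq_matI) (auto simp: mat_diag_def)

lemma mult_block_diag_mat:
  fixes A B :: "'a :: semiring_1 mat"
  assumes "A \<in> carrier_mat m m" "B \<in> carrier_mat n n" "C \<in> carrier_mat m m" "D \<in> carrier_mat n n"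
  shows "four_block_mat A (0\<^sub>m m n) (0\<^sub>m n m) B * four_block_mat C (0\<^sub>m m n) (0\<^sub>m n m) D
    = four_block_mat (A * C) (0\<^sub>m m n) (0\<^sub>m n m) (B * D)"
proof -
  have "A * C + 0\<^sub>m m n * 0\<^sub>m n m = A * C" "A * 0\<^sub>m m n + 0\<^sub>m m n * D = 0\<^sub>m m n"
    "0\<^sub>m n m * C + B * 0\<^sub>m n m = 0\<^sub>m n m" "0\<^sub>m n m * 0\<^sub>m m n + B * D = B * D"
    using assms by (auto intro!: eq_matI)
  then show ?thesis using assms by (subst mult_four_block_mat[of _ m m _ n _ n _ _ m _ n]) auto
qed

text \<open>Deflation: the reflection \<open>H\<close> moves a unit eigenvector to the first
  coordinate, so by symmetry \<open>H * A * H\<close> splits into the eigenvalue and a block of size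
  \<open>n\<close>, to which the induction hypothesis applies.\<close>

theorem symmetric_matrix_diagonalization:
  fixes A :: "real mat"
  assumes "A \<in> carrier_mat n n" "A\<^sup>T = A"
  shows "\<exists>P d. orthogonal_matrix n P \<and> A = P * mat_diag n d * P\<^sup>T"
  using assms
proof (induction n arbitrary: A)
  case 0
  then show ?case
    by (intro exI[of _ "1\<^sub>m 0"]) (auto simp: orthogonal_matrix_def intro!: eq_matI)
next
  case (Suc n)
  note A = Suc.prems
  obtain e v where v: "v \<in> carrier_vec (Suc n)" "v \<bullet> v = 1" "A *\<^sub>v v = e \<cdot>\<^sub>v v"
    using symmetric_real_eigenvector[OF A zero_less_Suc] .
  obtain H where H: "orthogonal_matrix (Suc n) H" "H\<^sup>T = H" "col H 0 = v"
    using orthogonal_matrix_first_column[OF v(1,2)] .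
  have Hc: "H \<in> carrier_mat (Suc n) (Suc n)" and HH: "H * H = 1\<^sub>m (Suc n)"
    using H by (auto simp: orthogonal_matrix_def)
  define C where "C = H * A * H"
  have Cc: "C \<in> carrier_mat (Suc n) (Suc n)" using A Hc by (simp add: C_def)
  have Csym: "C\<^sup>T = C"
    unfolding C_def transpose_mult3[OF Hc A(1) Hc] A(2) H(2)
    using A(1) Hc by (simp add: assoc_mult_mat[of _ "Suc n" "Suc n" _ "Suc n" _ "Suc n"])
  have A_C: "A = H * C * H"
  proof -
    have "H * C * H = (H * H) * A * (H * H)"
      unfolding C_def using A Hc by (simp add: assoc_mult_mat[of _ "Suc n" "Suc n" _ "Suc n" _ "Suc n"])
    then show ?thesis using HH A by simp
  qed
  have col0: "C $$ (i, 0) = (if i = 0 then e else 0)" if i: "i < Suc n" for i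
  proof -
    have "col C 0 = (H * A) *\<^sub>v col H 0"
      unfolding C_def by (rule col_mult2[OF mult_carrier_mat[OF Hc A(1)] Hc zero_less_Suc])
    also have "\<dots> = H *\<^sub>v (A *\<^sub>v v)"
      unfolding H(3) by (rule assoc_mult_mat_vec[OF Hc A(1) v(1)])
    also have "\<dots> = e \<cdot>\<^sub>v (H *\<^sub>v col H 0)"
      unfolding v(3) H(3) using Hc v(1) by (simp add: mult_mat_vec)
    also have "H *\<^sub>v col H 0 = col (1\<^sub>m (Suc n)) 0"
      unfolding HH[symmetric] by (rule col_mult2[OF Hc Hc zero_less_Suc, symmetric])
    finally have "col C 0 $ i = (if i = 0 then e else 0)" using i by simp
    then show ?thesis using i Cc by simp
  qed
  define D where "D = mat n n (\<lambda>(i, j). C $$ (Suc i, Suc j))"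
  have Csym': "C $$ (i, j) = C $$ (j, i)" if "i < Suc n" "j < Suc n" for i j
    using Csym Cc that by (metis carrier_matD index_transpose_mat(1))
  have "D\<^sup>T = D" unfolding D_def by (intro eq_matI) (auto intro: Csym')
  then obtain Q d where Q: "orthogonal_matrix n Q" "D = Q * mat_diag n d * Q\<^sup>T"
    using Suc.IH[of D] by (auto simp: D_def)
  have Qc: "Q \<in> carrier_mat n n" "Q\<^sup>T * Q = 1\<^sub>m n" using Q by (auto simp: orthogonal_matrix_def)
  define G where "G = four_block_mat (1\<^sub>m 1) (0\<^sub>m 1 n) (0\<^sub>m n 1) Q"
  have Gc: "G \<in> carrier_mat (Suc n) (Suc n)" using four_block_carrier_mat[OF one_carrier_mat[of 1] Qc(1)] by (simp add: G_def)
  have GT: "G\<^sup>T = four_block_mat (1\<^sub>m 1) (0\<^sub>m 1 n) (0\<^sub>m n 1) (Q\<^sup>T)"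
    unfolding G_def using Qc by (subst transpose_four_block_mat[of _ 1 1 _ n _ n]) auto
  have GG: "G\<^sup>T * G = 1\<^sub>m (Suc n)"
  proof -
    have "G\<^sup>T * G = four_block_mat (1\<^sub>m 1) (0\<^sub>m 1 n) (0\<^sub>m n 1) (1\<^sub>m n)"
      unfolding GT unfolding G_def using Qc by (subst mult_block_diag_mat) auto
    then show ?thesis by (auto intro!: eq_matI)
  qed
  let ?d = "\<lambda>k. case k of 0 \<Rightarrow> e | Suc k \<Rightarrow> d k"
  have E: "mat_diag (Suc n) ?d = four_block_mat (mat 1 1 (\<lambda>_. e)) (0\<^sub>m 1 n) (0\<^sub>m n 1) (mat_diag n d)"
    by (intro eq_matI) (auto simp: mat_diag_def split: nat.splits)
  have "G * mat_diag (Suc n) ?d * G\<^sup>T = four_block_mat (mat 1 1 (\<lambda>_. e)) (0\<^sub>m 1 n) (0\<^sub>m n 1) D"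
  proof -
    have "G * mat_diag (Suc n) ?d
        = four_block_mat (mat 1 1 (\<lambda>_. e)) (0\<^sub>m 1 n) (0\<^sub>m n 1) (Q * mat_diag n d)"
      unfolding E unfolding G_def using Qc by (subst mult_block_diag_mat) auto
    then show ?thesis
      unfolding GT Q(2) using Qc by (simp only:, subst mult_block_diag_mat) auto
  qed
  also have "\<dots> = C"
    using Cc col0 Csym'[of 0] by (intro eq_matI) (auto simp: D_def less_Suc_eq_0_disj)
  finally have C: "C = G * mat_diag (Suc n) ?d * G\<^sup>T" ..
  let ?P = "H * G"
  have PT: "?P\<^sup>T = G\<^sup>T * H" using Hc Gc H(2) by (subst transpose_mult[of _ "Suc n" "Suc n" _ "Suc n"]) auto
  have "?P\<^sup>T * ?P = G\<^sup>T * ((H * H) * G)"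
    unfolding PT using Hc Gc by (simp add: assoc_mult_mat[of _ "Suc n" "Suc n" _ "Suc n" _ "Suc n"])
  then have "orthogonal_matrix (Suc n) ?P"
    using HH GG Gc Hc by (simp add: orthogonal_matrix_def)
  moreover have "A = ?P * mat_diag (Suc n) ?d * ?P\<^sup>T"
    unfolding PT A_C unfolding C using Hc Gc
    by (simp add: assoc_mult_mat[of _ "Suc n" "Suc n" _ "Suc n" _ "Suc n"]
        mult_carrier_mat[of _ "Suc n" "Suc n" _ "Suc n"])
  ultimately show ?case by blast
qed

subsection \<open>Singular values of semidefinite matrices\<close>

lemma diag_conjugation_index:
  assumes "P \<in> carrier_mat n n" "i < n" "j < n"
  shows "(P * mat_diag n d * P\<^sup>T) $$ (i, j) = (\<Sum>k<n. d k * P $$ (i, k) * (P $$ (j, k) :: real))"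
proof -
  have "(P * mat_diag n d * P\<^sup>T) $$ (i, j) = (\<Sum>k<n. P $$ (i, k) * d k * P $$ (j, k))"
    unfolding mat_diag_mult_right[OF assms(1)] using assms
    by (simp add: scalar_prod_def atLeast0LessThan)
  then show ?thesis by (simp only: mult.commute[of "P $$ (i, _)"])
qed

lemma orthogonal_matrix_cols:
  assumes "orthogonal_matrix n P" "k < n" "q < n"
  shows "(\<Sum>i<n. P $$ (i, k) * P $$ (i, q)) = (if k = q then 1 else 0)"
proof -
  have Pc: "P \<in> carrier_mat n n" using assms by (simp add: orthogonal_matrix_def)
  have "(P\<^sup>T * P) $$ (k, q) = (\<Sum>i<n. P $$ (i, k) * P $$ (i, q))"
    using Pc assms(2,3) by (simp add: scalar_prod_def atLeast0LessThan)
  then show ?thesis using assms by (simp add: orthogonal_matrix_def)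
qed

lemma orthogonal_matrix_rows:
  assumes "orthogonal_matrix n P" "i < n" "j < n"
  shows "(\<Sum>k<n. P $$ (i, k) * P $$ (j, k)) = (if i = j then 1 else 0)"
proof -
  have Pc: "P \<in> carrier_mat n n" using assms by (simp add: orthogonal_matrix_def)
  have "(P * P\<^sup>T) $$ (i, j) = (\<Sum>k<n. P $$ (i, k) * P $$ (j, k))"
    using Pc assms(2,3) by (simp add: scalar_prod_def atLeast0LessThan)
  then show ?thesis using assms by (simp add: orthogonal_matrix_transpose_right)
qed

lemma antimono_permutation:
  fixes d :: "nat \<Rightarrow> real"
  obtains \<pi> where "\<pi> permutes {..<n}" "\<And>k q. k \<le> q \<Longrightarrow> q < n \<Longrightarrow> d (\<pi> q) \<le> d (\<pi> k)"
proof -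
  let ?xs = "map d [0..<n]"
  have "mset (rev (sort ?xs)) = mset ?xs" by simp
  then obtain \<pi> where p: "\<pi> permutes {..<length ?xs}" "permute_list \<pi> ?xs = rev (sort ?xs)"
    by (rule mset_eq_permutation)
  have nth: "rev (sort ?xs) ! k = d (\<pi> k)" if "k < n" for k
  proof -
    have "\<pi> k < n" using permutes_in_image[OF p(1), of k] that by simp
    then show ?thesis using that permute_list_nth[OF p(1), of k] p(2) by simp
  qed
  show ?thesis
  proof (rule that[of \<pi>])
    fix k q :: nat assume "k \<le> q" "q < n"
    then show "d (\<pi> q) \<le> d (\<pi> k)"
      using sorted_rev_nth_mono[of "rev (sort ?xs)" k q] nth[of k] nth[of q] by simp
  qed (use p in simp)
qed

text \<open>By similarity the characteristic polynomial of \<open>A\<^sup>T * A\<close> has the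
  roots \<open>l k * l k\<close> with multiplicity. Nonnegativity lets \<open>sqrt\<close> undo the
  squares, and monotonicity lets the sorted, reversed list agree with the given order.\<close>

lemma singular_values_diagonalized:
  assumes P: "orthogonal_matrix n P" and A: "A = P * mat_diag n l * P\<^sup>T"
    and nonneg: "\<And>k. k < n \<Longrightarrow> 0 \<le> l k" and mono: "\<And>k q. k \<le> q \<Longrightarrow> q < n \<Longrightarrow> l q \<le> l k"
  shows "singular_values A = map l [0..<n]"
proof -
  have Pc: "P \<in> carrier_mat n n" "P\<^sup>T * P = 1\<^sub>m n" using P by (auto simp: orthogonal_matrix_def)
  note assoc = assoc_mult_mat[of _ n n _ n _ n] mult_carrier_mat[of _ n n _ n]
  have At: "A\<^sup>T = A"
    unfolding A using Pc by (subst transpose_mult3[of _ n]) (auto simp: transpose_mat_diag assoc)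
  have "A\<^sup>T * A = P * mat_diag n l * (P\<^sup>T * P) * mat_diag n l * P\<^sup>T"
    unfolding At unfolding A using Pc(1) by (simp add: assoc)
  also have "\<dots> = P * (mat_diag n l * mat_diag n l) * P\<^sup>T"
    unfolding Pc(2) using Pc(1)
    by (simp add: assoc left_mult_one_mat[of _ n n] del: mat_diag_diag)
  finally have AA: "A\<^sup>T * A = P * mat_diag n (\<lambda>k. l k * l k) * P\<^sup>T" by simp
  have "similar_mat (A\<^sup>T * A) (mat_diag n (\<lambda>k. l k * l k))"
    unfolding similar_mat_def similar_mat_wit_def AA Let_def
    using Pc orthogonal_matrix_transpose_right[OF P]
    by (intro exI[of _ P] exI[of _ "P\<^sup>T"]) (auto simp: assoc)
  then have "char_poly (A\<^sup>T * A) = (\<Prod>a\<leftarrow>map (\<lambda>k. l k * l k) [0..<n]. [:- a, 1:])"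
    by (subst char_poly_similar, assumption, subst char_poly_upper_triangular[of _ n])
      (auto simp: mat_diag_def diag_mat_def intro!: arg_cong[where f = prod_list])
  moreover have "proots (\<Prod>a\<leftarrow>xs. [:- a, 1:]) = mset xs" for xs :: "real list"
  proof (induction xs)
    case (Cons x xs)
    have "(\<Prod>a\<leftarrow>xs. [:- a, 1:]) \<noteq> 0" by (auto simp: prod_list_zero_iff)
    then show ?case using Cons by (subst list.map, subst prod_list.Cons, subst proots_mult) auto
  qed simp
  ultimately have "proots (char_poly (A\<^sup>T * A)) = mset (map (\<lambda>k. l k * l k) [0..<n])"
    by (simp only:)
  then have "image_mset sqrt (proots (char_poly (A\<^sup>T * A))) = mset (map l [0..<n])"
    using nonneg by (auto intro!: image_mset_cong simp: o_def image_mset.compositionality)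
  moreover have "sort (map l [0..<n]) = rev (map l [0..<n])"
    by (rule properties_for_sort) (auto simp: sorted_wrt_iff_nth_less rev_nth intro: mono)
  ultimately show ?thesis
    unfolding singular_values_def by (simp only: sorted_list_of_multiset_mset rev_rev_ident)
qed

lemma spsd_quadratic_form:
  assumes "spsd n A"
  shows "0 \<le> (\<Sum>a<n. \<Sum>b<n. x a * A $$ (a, b) * x b)"
proof -
  have "vec n x \<bullet> (A *\<^sub>v vec n x) = (\<Sum>a<n. \<Sum>b<n. x a * A $$ (a, b) * x b)"
    using assms by (auto simp: spsd_def scalar_prod_def atLeast0LessThan sum_distrib_left mult.assoc
        intro!: sum.cong)
  then show ?thesis using assms unfolding spsd_def by (metis vec_carrier)
qed

lemma spsd_sym:
  assumes "spsd n A" "a < n" "b < n"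
  shows "A $$ (a, b) = A $$ (b, a)"
proof -
  have "A \<in> carrier_mat n n" using assms by (simp add: spsd_def)
  then have "A\<^sup>T $$ (a, b) = A $$ (b, a)" using assms by simp
  then show ?thesis using assms by (simp add: spsd_def)
qed

text \<open>The quadratic form at column \<open>k\<close> of \<open>Q\<close> is the eigenvalue
  \<open>d k\<close>, which is therefore nonnegative. Permuting the columns into decreasing order of
  \<open>d\<close> turns eigenvalues into singular values.\<close>

lemma spsd_diagonalization:
  assumes A: "spsd n A"
  obtains P where "orthogonal_matrix n P" "A = P * mat_diag n (\<lambda>k. sigma (Suc k) A) * P\<^sup>T"
    "singular_values A = map (\<lambda>k. sigma (Suc k) A) [0..<n]"
    "\<And>k. k < n \<Longrightarrow> 0 \<le> sigma (Suc k) A"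
    "\<And>k q. k \<le> q \<Longrightarrow> q < n \<Longrightarrow> sigma (Suc q) A \<le> sigma (Suc k) A"
proof -
  have Ac: "A \<in> carrier_mat n n" "A\<^sup>T = A" using A by (auto simp: spsd_def)
  obtain Q d where Q: "orthogonal_matrix n Q" "A = Q * mat_diag n d * Q\<^sup>T"
    using symmetric_matrix_diagonalization[OF Ac] by blast
  have Qc: "Q \<in> carrier_mat n n" using Q by (simp add: orthogonal_matrix_def)
  have Aij: "A $$ (i, j) = (\<Sum>k<n. d k * Q $$ (i, k) * Q $$ (j, k))" if "i < n" "j < n" for i j
    unfolding Q(2) using diag_conjugation_index[OF Qc that] .
  have d: "0 \<le> d k" if k: "k < n" for k
  proof -
    have "(\<Sum>a<n. \<Sum>b<n. Q $$ (a, k) * A $$ (a, b) * Q $$ (b, k))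
        = (\<Sum>a<n. \<Sum>b<n. \<Sum>q<n. d q * (Q $$ (a, q) * Q $$ (a, k)) * (Q $$ (b, q) * Q $$ (b, k)))"
      by (intro sum.cong refl) (simp add: Aij sum_distrib_left sum_distrib_right mult_ac)
    also have "\<dots> = (\<Sum>q<n. \<Sum>a<n. \<Sum>b<n. d q * (Q $$ (a, q) * Q $$ (a, k)) * (Q $$ (b, q) * Q $$ (b, k)))"
      by (subst (2) sum.swap, subst sum.swap, rule refl)
    also have "\<dots> = (\<Sum>q<n. d q * (if q = k then 1 else 0) * (if q = k then 1 else 0))"
      using orthogonal_matrix_cols[OF Q(1) _ k]
      by (intro sum.cong refl) (simp add: sum_distrib_left[symmetric] sum_distrib_right[symmetric])
    also have "\<dots> = d k" using k by (simp add: if_distrib[of "\<lambda>x. _ * x"] cong: if_cong)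
    finally show ?thesis using spsd_quadratic_form[OF A, of "\<lambda>a. Q $$ (a, k)"] by simp
  qed
  obtain \<pi> where \<pi>: "\<pi> permutes {..<n}" "\<And>k q. k \<le> q \<Longrightarrow> q < n \<Longrightarrow> d (\<pi> q) \<le> d (\<pi> k)"
    using antimono_permutation[of n d] by blast
  have \<pi>n: "\<pi> k < n" if "k < n" for k using permutes_in_image[OF \<pi>(1), of k] that by simp
  have inj: "\<pi> k = \<pi> q \<longleftrightarrow> k = q" for k q using permutes_inj[OF \<pi>(1)] by (auto dest: injD)
  define P where "P = mat n n (\<lambda>(i, k). Q $$ (i, \<pi> k))"
  have Pc: "P \<in> carrier_mat n n" by (simp add: P_def)
  have P: "orthogonal_matrix n P"
    unfolding orthogonal_matrix_def
  proof (intro conjI Pc eq_matI)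
    fix k q assume "k < dim_row (1\<^sub>m n :: real mat)" "q < dim_col (1\<^sub>m n :: real mat)"
    then show "(P\<^sup>T * P) $$ (k, q) = 1\<^sub>m n $$ (k, q)"
      using orthogonal_matrix_cols[OF Q(1), of "\<pi> k" "\<pi> q"] \<pi>n
      by (simp add: P_def scalar_prod_def atLeast0LessThan inj)
  qed (auto simp: P_def)
  have AP: "A = P * mat_diag n (d \<circ> \<pi>) * P\<^sup>T"
  proof (rule eq_matI)
    fix i j assume "i < dim_row (P * mat_diag n (d \<circ> \<pi>) * P\<^sup>T)" "j < dim_col (P * mat_diag n (d \<circ> \<pi>) * P\<^sup>T)"
    then have ij: "i < n" "j < n" by (auto simp: P_def)
    have "A $$ (i, j) = (\<Sum>k<n. d (\<pi> k) * Q $$ (i, \<pi> k) * Q $$ (j, \<pi> k))"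
      unfolding Aij[OF ij] using sum.permute[OF \<pi>(1)] by (simp add: o_def)
    then show "A $$ (i, j) = (P * mat_diag n (d \<circ> \<pi>) * P\<^sup>T) $$ (i, j)"
      unfolding diag_conjugation_index[OF Pc ij] using ij by (simp add: P_def)
  qed (use Ac in \<open>auto simp: P_def\<close>)
  have sv: "singular_values A = map (d \<circ> \<pi>) [0..<n]"
    by (rule singular_values_diagonalized[OF P AP]) (auto intro: d \<pi>n \<pi>(2))
  have sig: "sigma (Suc k) A = d (\<pi> k)" if "k < n" for k
    using that unfolding sigma_def sv by simp
  have "mat_diag n (d \<circ> \<pi>) = mat_diag n (\<lambda>k. sigma (Suc k) A)"
    by (intro eq_matI) (auto simp: mat_diag_def sig)
  then show ?thesis
    using P AP sv sig d \<pi>n \<pi>(2) by (intro that[of P]) auto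
qed

lemma sigma_nonneg:
  assumes "spsd n A"
  shows "0 \<le> sigma j A"
proof (rule spsd_diagonalization[OF assms])
  assume sv: "singular_values A = map (\<lambda>k. sigma (Suc k) A) [0..<n]"
    and nonneg: "\<And>k. k < n \<Longrightarrow> 0 \<le> sigma (Suc k) A"
  show ?thesis
  proof (cases "1 \<le> j \<and> j \<le> n")
    case True
    then show ?thesis using nonneg[of "j - 1"] by auto
  next
    case False
    moreover have "length (singular_values A) = n" by (subst sv) simp
    ultimately have "sigma j A = 0" unfolding sigma_def by auto
    then show ?thesis by simp
  qed
qed

lemma sigma_antimono:
  assumes "spsd n A" "1 \<le> j" "j \<le> k"
  shows "sigma k A \<le> sigma j A"
proof (rule spsd_diagonalization[OF assms(1)])
  assume sv: "singular_values A = map (\<lambda>k. sigma (Suc k) A) [0..<n]"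
    and mono: "\<And>k q. k \<le> q \<Longrightarrow> q < n \<Longrightarrow> sigma (Suc q) A \<le> sigma (Suc k) A"
  show ?thesis
  proof (cases "k \<le> n")
    case True
    then show ?thesis using mono[of "j - 1" "k - 1"] assms by simp
  next
    case False
    moreover have "length (singular_values A) = n" by (subst sv) simp
    ultimately have "sigma k A = 0" unfolding sigma_def by auto
    then show ?thesis using sigma_nonneg[OF assms(1)] by simp
  qed
qed

lemma proj_volume_nonneg: "spsd n A \<Longrightarrow> 0 \<le> proj_volume r A"
  unfolding proj_volume_def by (intro prod_nonneg ballI sigma_nonneg)

lemma proj_volume_lessThan: "proj_volume r A = (\<Prod>k<r. sigma (Suc k) A)"
  unfolding proj_volume_def
  by (rule prod.reindex_bij_witness[of _ Suc "\<lambda>j. j - 1"]) auto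

subsection \<open>Eigensystems of principal submatrices\<close>

text \<open>A spectral decomposition of \<open>B\<^sub>I\<^sub>I\<close> with eigenvectors indexed by \<open>I\<close> itself, so that index sets
  can be compared without renumbering; the values \<open>u k a\<close> for \<open>a \<notin> I\<close> are irrelevant.\<close>

definition eigensystem ::
    "nat set \<Rightarrow> (nat \<Rightarrow> nat \<Rightarrow> real) \<Rightarrow> (nat \<Rightarrow> nat \<Rightarrow> real) \<Rightarrow> (nat \<Rightarrow> real) \<Rightarrow> bool" where
  "eigensystem I B u l \<longleftrightarrow> finite I \<and>
     (\<forall>k<card I. \<forall>q<card I. (\<Sum>a\<in>I. u k a * u q a) = (if k = q then 1 else 0)) \<and>
     (\<forall>a\<in>I. \<forall>b\<in>I. (\<Sum>k<card I. u k a * u k b) = (if a = b then 1 else 0)) \<and>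
     (\<forall>a\<in>I. \<forall>b\<in>I. B a b = (\<Sum>k<card I. l k * u k a * u k b)) \<and>
     (\<forall>k<card I. 0 \<le> l k) \<and> (\<forall>k q. k \<le> q \<and> q < card I \<longrightarrow> l q \<le> l k)"

lemma eigensystemD:
  assumes "eigensystem I B u l"
  shows "finite I"
    and "k < card I \<Longrightarrow> q < card I \<Longrightarrow> (\<Sum>a\<in>I. u k a * u q a) = (if k = q then 1 else 0)"
    and "a \<in> I \<Longrightarrow> b \<in> I \<Longrightarrow> (\<Sum>k<card I. u k a * u k b) = (if a = b then 1 else 0)"
    and "a \<in> I \<Longrightarrow> b \<in> I \<Longrightarrow> B a b = (\<Sum>k<card I. l k * u k a * u k b)"
    and "k < card I \<Longrightarrow> 0 \<le> l k"
    and "k \<le> q \<Longrightarrow> q < card I \<Longrightarrow> l q \<le> l k"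
proof -
  note D = assms[unfolded eigensystem_def]
  show "finite I" by (rule D[THEN conjunct1])
  show "k < card I \<Longrightarrow> q < card I \<Longrightarrow> (\<Sum>a\<in>I. u k a * u q a) = (if k = q then 1 else 0)"
    by (rule D[THEN conjunct2, THEN conjunct1, rule_format])
  show "a \<in> I \<Longrightarrow> b \<in> I \<Longrightarrow> (\<Sum>k<card I. u k a * u k b) = (if a = b then 1 else 0)"
    by (rule D[THEN conjunct2, THEN conjunct2, THEN conjunct1, rule_format])
  show "a \<in> I \<Longrightarrow> b \<in> I \<Longrightarrow> B a b = (\<Sum>k<card I. l k * u k a * u k b)"
    by (rule D[THEN conjunct2, THEN conjunct2, THEN conjunct2, THEN conjunct1, rule_format])
  show "k < card I \<Longrightarrow> 0 \<le> l k"
    by (rule D[THEN conjunct2, THEN conjunct2, THEN conjunct2, THEN conjunct2, THEN conjunct1, rule_format])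
  show "k \<le> q \<Longrightarrow> q < card I \<Longrightarrow> l q \<le> l k"
    by (rule D[THEN conjunct2, THEN conjunct2, THEN conjunct2, THEN conjunct2, THEN conjunct2, rule_format, OF conjI])
qed

text \<open>A kernel that is a sum of products decouples the two variables. This is the common
  computation behind the diagonalized form, Parseval's identity, the elimination steps and the CUR
  product.\<close>

lemma sum_quadratic_expand:
  fixes f g :: "nat \<Rightarrow> real"
  shows "(\<Sum>a\<in>I. \<Sum>b\<in>J. f a * (\<Sum>k<n. l k * u k a * v k b) * g b)
    = (\<Sum>k<n. l k * (\<Sum>a\<in>I. u k a * f a) * (\<Sum>b\<in>J. v k b * g b))"
proof -
  have "(\<Sum>a\<in>I. \<Sum>b\<in>J. f a * (\<Sum>k<n. l k * u k a * v k b) * g b)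
      = (\<Sum>a\<in>I. \<Sum>b\<in>J. \<Sum>k<n. l k * (u k a * f a) * (v k b * g b))"
    by (intro sum.cong refl) (simp add: sum_distrib_left sum_distrib_right mult_ac)
  also have "\<dots> = (\<Sum>k<n. \<Sum>a\<in>I. \<Sum>b\<in>J. l k * (u k a * f a) * (v k b * g b))"
    by (subst (2) sum.swap, subst sum.swap, rule refl)
  also have "\<dots> = (\<Sum>k<n. l k * (\<Sum>a\<in>I. u k a * f a) * (\<Sum>b\<in>J. v k b * g b))"
    by (intro sum.cong refl) (simp add: sum_distrib_left sum_distrib_right mult_ac)
  finally show ?thesis .
qed

lemma eigensystem_form:
  assumes "eigensystem I B u l"
  shows "(\<Sum>a\<in>I. \<Sum>b\<in>I. f a * B a b * g b)
    = (\<Sum>k<card I. l k * (\<Sum>a\<in>I. u k a * f a) * (\<Sum>a\<in>I. u k a * g a))"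
proof -
  have "(\<Sum>a\<in>I. \<Sum>b\<in>I. f a * B a b * g b)
      = (\<Sum>a\<in>I. \<Sum>b\<in>I. f a * (\<Sum>k<card I. l k * u k a * u k b) * g b)"
    using eigensystemD(4)[OF assms] by (intro sum.cong refl) simp
  then show ?thesis by (simp only: sum_quadratic_expand)
qed

lemma eigensystem_parseval:
  assumes "eigensystem I B u l"
  shows "(\<Sum>a\<in>I. f a * g a) = (\<Sum>k<card I. (\<Sum>a\<in>I. u k a * f a) * (\<Sum>a\<in>I. u k a * g a))"
proof -
  have "(\<Sum>a\<in>I. f a * g a) = (\<Sum>a\<in>I. \<Sum>b\<in>I. if a = b then f a * g b else 0)"
    using eigensystemD(1)[OF assms] by simp
  also have "\<dots> = (\<Sum>a\<in>I. \<Sum>b\<in>I. f a * (\<Sum>k<card I. 1 * u k a * u k b) * g b)"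
    using eigensystemD(3)[OF assms] by (intro sum.cong refl) simp
  finally show ?thesis unfolding sum_quadratic_expand by simp
qed

lemma eigensystem_sym:
  assumes "eigensystem I B u l" "a \<in> I" "b \<in> I"
  shows "B a b = B b a"
  using eigensystemD(4)[OF assms] eigensystemD(4)[OF assms(1,3,2)] by (simp add: mult_ac)

lemma eigensystem_eigenvector:
  assumes E: "eigensystem I B u l" and a: "a \<in> I" and k: "k < card I"
  shows "(\<Sum>b\<in>I. B a b * u k b) = l k * u k a"
proof -
  have "B a b * u k b = (\<Sum>q<card I. l q * u q a * (u q b * u k b))" if "b \<in> I" for b
    unfolding eigensystemD(4)[OF E a that] sum_distrib_right by (simp only: mult.assoc)
  then have "(\<Sum>b\<in>I. B a b * u k b) = (\<Sum>b\<in>I. \<Sum>q<card I. l q * u q a * (u q b * u k b))"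
    by (intro sum.cong refl) simp
  also have "\<dots> = (\<Sum>q<card I. l q * u q a * (\<Sum>b\<in>I. u q b * u k b))"
    by (subst sum.swap) (simp add: sum_distrib_left)
  also have "\<dots> = (\<Sum>q<card I. if q = k then l k * u k a else 0)"
    using k by (intro sum.cong refl) (simp add: eigensystemD(2)[OF E])
  finally show ?thesis using k by simp
qed

text \<open>In the coordinates of the eigenbasis both sides are Gram matrices of the same vectors,
  with weights \<open>l\<close> and 1. The Gram determinant on the right accounts for columns of
  \<open>X\<close> that are not orthonormal.\<close>

lemma det_compression_le:
  assumes E: "eigensystem I B u l"
  shows "det (mat r r (\<lambda>(i, j). \<Sum>a\<in>I. \<Sum>b\<in>I. X a i * B a b * X b j))
    \<le> (\<Prod>k<r. l k) * det (mat r r (\<lambda>(i, j). \<Sum>a\<in>I. X a i * X a j))"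
  unfolding eigensystem_form[OF E]
  by (subst eigensystem_parseval[OF E], intro det_weighted_gram_le eigensystemD(5,6)[OF E])

text \<open>In eigenbasis coordinates a single squared minor survives: the overlap of the columns of
  \<open>X\<close> with the \<open>r\<close> leading eigenvectors.\<close>

lemma det_compression_ge:
  assumes E: "eigensystem I B u l" and r: "r \<le> card I"
  shows "(\<Prod>k<r. l k) * (det (mat r r (\<lambda>(i, j). \<Sum>a\<in>I. u i a * X a j)))\<^sup>2
    \<le> det (mat r r (\<lambda>(i, j). \<Sum>a\<in>I. \<Sum>b\<in>I. X a i * B a b * X b j))"
  unfolding eigensystem_form[OF E]
  using det_weighted_gram_ge[OF eigensystemD(5)[OF E] r, where X = "\<lambda>k i. \<Sum>a\<in>I. u k a * X a i"]
  by (simp add: row_minor_def)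

section \<open>Variational characterization and interlacing\<close>

text \<open>The \<open>t\<close> equations in \<open>t + 1\<close> unknowns are padded with a zero
  row to a square matrix, which is singular.\<close>

lemma exists_kernel_vector:
  fixes M :: "nat \<Rightarrow> nat \<Rightarrow> real"
  obtains y where "\<And>s. s < t \<Longrightarrow> (\<Sum>k<Suc t. M s k * y k) = 0" "0 < (\<Sum>k<Suc t. (y k)\<^sup>2)"
proof -
  let ?A = "mat (Suc t) (Suc t) (\<lambda>(s, k). if s < t then M s k else 0)"
  have "det ?A = 0"
  proof -
    have "(\<Prod>i = 0..<Suc t. ?A $$ (i, p i)) = 0" if "p permutes {0..<Suc t}" for p
      using that permutes_in_image[OF that, of t] by (intro prod_zero bexI[of _ t]) auto
    then show ?thesis by (subst det_def'[of _ "Suc t"]) (auto intro!: sum.neutral)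
  qed
  then obtain v where v: "v \<in> carrier_vec (Suc t)" "v \<noteq> 0\<^sub>v (Suc t)" "?A *\<^sub>v v = 0\<^sub>v (Suc t)"
    using det_0_iff_vec_prod_zero[of ?A "Suc t"] by auto
  show ?thesis
  proof (rule that[of "\<lambda>k. v $ k"])
    fix s assume s: "s < t"
    have "(?A *\<^sub>v v) $ s = (\<Sum>k<Suc t. M s k * v $ k)"
      using s v(1) by (simp add: scalar_prod_def atLeast0LessThan del: sum.lessThan_Suc)
    then show "(\<Sum>k<Suc t. M s k * v $ k) = 0" using s v(3) by simp
  next
    obtain k where "k < Suc t" "v $ k \<noteq> 0" using v(1,2) by (metis eq_vecI carrier_vecD index_zero_vec)
    then show "0 < (\<Sum>k<Suc t. (v $ k)\<^sup>2)"
      by (intro sum_pos2[of _ k]) auto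
  qed
qed

text \<open>One half of Courant--Fischer: \<open>t\<close> linear conditions leave a nonzero vector
  in the span of the \<open>t + 1\<close> leading eigenvectors, and there the Rayleigh quotient is
  at least \<open>l t\<close>.\<close>

lemma eigensystem_exists_large_form:
  assumes E: "eigensystem I B u l" and t: "t < card I"
  obtains x where "\<And>s. s < t \<Longrightarrow> (\<Sum>a\<in>I. c s a * x a) = 0" "0 < (\<Sum>a\<in>I. x a * x a)"
    "l t * (\<Sum>a\<in>I. x a * x a) \<le> (\<Sum>a\<in>I. \<Sum>b\<in>I. x a * B a b * x b)"
proof -
  obtain y where y: "\<And>s. s < t \<Longrightarrow> (\<Sum>k<Suc t. (\<Sum>a\<in>I. c s a * u k a) * y k) = 0"
    "0 < (\<Sum>k<Suc t. (y k)\<^sup>2)"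
    using exists_kernel_vector[of t "\<lambda>s k. \<Sum>a\<in>I. c s a * u k a"] by blast
  define x where "x a = (\<Sum>k<Suc t. y k * u k a)" for a
  have pair: "(\<Sum>a\<in>I. f a * x a) = (\<Sum>k<Suc t. (\<Sum>a\<in>I. f a * u k a) * y k)" for f
    unfolding x_def sum_distrib_left sum_distrib_right
    by (subst sum.swap) (simp only: mult_ac)
  have coeff: "(\<Sum>a\<in>I. u q a * x a) = (if q < Suc t then y q else 0)" if q: "q < card I" for q
  proof -
    have "(\<Sum>a\<in>I. u q a * x a) = (\<Sum>k<Suc t. (if q = k then y k else 0))"
      unfolding pair using q t by (intro sum.cong refl) (simp add: eigensystemD(2)[OF E])
    then show ?thesis by (simp del: sum.lessThan_Suc)
  qed
  have sub: "{..<Suc t} \<subseteq> {..<card I}" using t by auto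
  have norm: "(\<Sum>a\<in>I. x a * x a) = (\<Sum>k<Suc t. (y k)\<^sup>2)"
    by (subst eigensystem_parseval[OF E], rule sum.mono_neutral_cong_right[OF _ sub]) (use t in \<open>auto simp: coeff power2_eq_square\<close>)
  have form: "(\<Sum>a\<in>I. \<Sum>b\<in>I. x a * B a b * x b) = (\<Sum>k<Suc t. l k * (y k)\<^sup>2)"
    unfolding eigensystem_form[OF E]
    by (rule sum.mono_neutral_cong_right[OF _ sub]) (use t in \<open>auto simp: coeff power2_eq_square\<close>)
  show ?thesis
  proof (rule that[of x])
    show "(\<Sum>a\<in>I. c s a * x a) = 0" if "s < t" for s using y(1)[OF that] pair by simp
    show "0 < (\<Sum>a\<in>I. x a * x a)" using y(2) norm by simp
    show "l t * (\<Sum>a\<in>I. x a * x a) \<le> (\<Sum>a\<in>I. \<Sum>b\<in>I. x a * B a b * x b)"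
      unfolding norm form sum_distrib_left using t
      by (intro sum_mono mult_right_mono eigensystemD(6)[OF E]) auto
  qed
qed

text \<open>A vector on \<open>I\<close> with form at least \<open>l t\<close> can be chosen so that
  its extension by zero is orthogonal to the first \<open>t\<close> eigenvectors of
  \<open>J\<close>. The extension keeps form and norm, and by the orthogonality its form is at most
  \<open>m t\<close> times the squared norm.\<close>

lemma eigensystem_interlacing:
  assumes E: "eigensystem I B u l" and F: "eigensystem J B v m" and IJ: "I \<subseteq> J" and t: "t < card I"
  shows "l t \<le> m t"
proof -
  obtain x where x: "\<And>s. s < t \<Longrightarrow> (\<Sum>a\<in>I. v s a * x a) = 0" "0 < (\<Sum>a\<in>I. x a * x a)"
    "l t * (\<Sum>a\<in>I. x a * x a) \<le> (\<Sum>a\<in>I. \<Sum>b\<in>I. x a * B a b * x b)"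
    using eigensystem_exists_large_form[OF E t, of v] by blast
  have J: "finite J" using eigensystemD(1)[OF F] .
  have tJ: "t < card J" using t card_mono[OF J IJ] by simp
  define y where "y a = (if a \<in> I then x a else 0)" for a
  have y: "(\<Sum>a\<in>J. f a * y a) = (\<Sum>a\<in>I. f a * x a)" for f :: "nat \<Rightarrow> real"
    using J IJ by (intro sum.mono_neutral_cong_right) (auto simp: y_def)
  have yy: "(\<Sum>a\<in>J. y a * y a) = (\<Sum>a\<in>I. x a * x a)"
    using J IJ by (intro sum.mono_neutral_cong_right) (auto simp: y_def)
  have form: "(\<Sum>a\<in>J. \<Sum>b\<in>J. y a * B a b * y b) = (\<Sum>a\<in>I. \<Sum>b\<in>I. x a * B a b * x b)"
    unfolding y using J IJ finite_subset[OF IJ J]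
    by (intro sum.mono_neutral_cong_right) (auto simp: y_def)
  have "(\<Sum>a\<in>J. \<Sum>b\<in>J. y a * B a b * y b)
      = (\<Sum>k<card J. m k * ((\<Sum>a\<in>J. v k a * y a) * (\<Sum>a\<in>J. v k a * y a)))"
    unfolding eigensystem_form[OF F] by (simp only: mult.assoc)
  also have "\<dots> \<le> (\<Sum>k<card J. m t * ((\<Sum>a\<in>J. v k a * y a) * (\<Sum>a\<in>J. v k a * y a)))"
  proof (rule sum_mono)
    fix k assume "k \<in> {..<card J}"
    then show "m k * ((\<Sum>a\<in>J. v k a * y a) * (\<Sum>a\<in>J. v k a * y a))
        \<le> m t * ((\<Sum>a\<in>J. v k a * y a) * (\<Sum>a\<in>J. v k a * y a))"
      using x(1)[of k] y[of "v k"] eigensystemD(6)[OF F, of t k]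
      by (cases "k < t") (auto intro: mult_right_mono)
  qed
  also have "\<dots> = m t * (\<Sum>a\<in>I. x a * x a)"
    using eigensystem_parseval[OF F, of y y] yy by (simp add: sum_distrib_left[symmetric])
  finally have "l t * (\<Sum>a\<in>I. x a * x a) \<le> m t * (\<Sum>a\<in>I. x a * x a)" using x(3) form by simp
  then show ?thesis using x(2) by simp
qed

section \<open>Volumes when an index is added or removed\<close>

text \<open>The matrix is L^T D L with \<open>L\<close> unit upper triangular. This is how
  elimination pivots become determinants.\<close>

lemma det_unit_triangular_congruence:
  fixes L :: "nat \<Rightarrow> nat \<Rightarrow> real"
  assumes "\<And>q i. i < q \<Longrightarrow> q < r \<Longrightarrow> L q i = 0" "\<And>q. q < r \<Longrightarrow> L q q = 1"
  shows "det (mat r r (\<lambda>(i, j). \<Sum>q<r. d q * L q i * L q j)) = (\<Prod>q<r. d q)"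
proof -
  let ?L = "mat r r (\<lambda>(q, i). L q i)"
  have "det ?L = prod_list (diag_mat ?L)"
    using assms(1) by (intro det_upper_triangular) auto
  also have "diag_mat ?L = map (\<lambda>q. 1) [0..<r]"
    using assms(2) by (auto simp: diag_mat_def)
  finally have L: "det ?L = 1" by (simp add: map_replicate_const)
  have "mat r r (\<lambda>(i, j). \<Sum>q<r. d q * L q i * L q j) = ?L\<^sup>T * (mat_diag r d * ?L)"
    by (intro eq_matI)
      (auto simp: mat_diag_mult_left[of _ _ r] scalar_prod_def atLeast0LessThan mult_ac)
  also have "det \<dots> = det (mat_diag r d)"
  proof -
    have "det (?L\<^sup>T * (mat_diag r d * ?L)) = det (?L\<^sup>T) * (det (mat_diag r d) * det ?L)"
      by (subst det_mult[of "?L\<^sup>T" r "mat_diag r d * ?L"], simp, rule mult_carrier_mat[of _ r r],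
          simp, simp, subst det_mult[of _ r]) simp_all
    then show ?thesis using L det_transpose[of ?L r] by simp
  qed
  also have "\<dots> = prod_list (diag_mat (mat_diag r d))"
    by (intro det_upper_triangular[of _ r]) (auto simp: mat_diag_def)
  also have "diag_mat (mat_diag r d) = map d [0..<r]"
    by (auto simp: diag_mat_def mat_diag_def)
  also have "prod_list (map d [0..<r]) = (\<Prod>q<r. d q)"
    by (simp add: prod.list_conv_set_nth atLeast0LessThan)
  finally show ?thesis .
qed

text \<open>The compression of \<open>B\<close> to the span of \<open>u\<^sub>0, \<dots>, u\<^sub>r\<^sub>-\<^sub>1\<close> and of the unit vector at \<open>j\<close> has the
  determinant on the left, as its last Schur complement is the truncation error at \<open>(j, j)\<close>.\<close>

lemma truncation_error_mult_volume_le: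
  assumes E: "eigensystem I B u l" and j: "j \<notin> I" and F: "eigensystem (insert j I) B v m"
    and r: "r \<le> card I"
  shows "(B j j - (\<Sum>k<r. inverse (l k) * (\<Sum>c\<in>I. u k c * B c j)\<^sup>2)) * (\<Prod>k<r. l k)
    \<le> (\<Prod>k<Suc r. m k)"
proof (cases "\<exists>k<r. l k = 0")
  case True
  then have "(\<Prod>k<r. l k) = 0" by auto
  moreover have "0 \<le> (\<Prod>k<Suc r. m k)"
    using r j eigensystemD(1)[OF E] by (intro prod_nonneg ballI eigensystemD(5)[OF F]) auto
  ultimately show ?thesis by (simp only: mult_zero_right)
next
  case False
  have I: "finite I" using eigensystemD(1)[OF E] .
  have sym: "B a b = B b a" if "a \<in> insert j I" "b \<in> insert j I" for a b
    using eigensystem_sym[OF F that] .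
  define h where "h k = (\<Sum>c\<in>I. u k c * B c j)" for k
  define e where "e = B j j - (\<Sum>k<r. inverse (l k) * (h k)\<^sup>2)"
  define X where "X a i = (if i < r then if a = j then 0 else u i a else if a = j then 1 else 0)" for a i :: nat
  \<comment> \<open>The compressed matrix is an arrow: diagonal \<open>l\<close>, border
    \<open>h\<close>, corner \<open>B j j\<close>. \<open>L\<close> and \<open>d\<close> are its
    triangular factorization, with the Schur complement \<open>e\<close> as last pivot.\<close>
  define L where "L q i = (if q = i then 1 else if q < r \<and> i = r then h q / l q else 0)" for q i
  define d where "d q = (if q < r then l q else e)" for q
  have gram: "mat (Suc r) (Suc r) (\<lambda>(i, i'). \<Sum>a\<in>insert j I. X a i * X a i') = 1\<^sub>m (Suc r)"
  proof (rule eq_matI)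
    fix i i' assume "i < dim_row (1\<^sub>m (Suc r) :: real mat)" "i' < dim_col (1\<^sub>m (Suc r) :: real mat)"
    then have ii: "i < Suc r" "i' < Suc r" by auto
    have "(\<Sum>a\<in>I. X a i * X a i') = (if i < r \<and> i' < r then \<Sum>a\<in>I. u i a * u i' a else 0)"
      using j by (auto simp: X_def intro!: sum.cong sum.neutral)
    then have "(\<Sum>a\<in>insert j I. X a i * X a i')
        = X j i * X j i' + (if i < r \<and> i' < r then if i = i' then 1 else 0 else 0)"
      using I j r eigensystemD(2)[OF E, of i i'] by simp
    then show "mat (Suc r) (Suc r) (\<lambda>(i, i'). \<Sum>a\<in>insert j I. X a i * X a i') $$ (i, i')
        = 1\<^sub>m (Suc r) $$ (i, i')"
      using ii by (auto simp: X_def)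
  qed auto
  have BI: "(\<Sum>b\<in>I. B a b * u k b) = l k * u k a" if "a \<in> I" "k < r" for a k
    using eigensystem_eigenvector[OF E that(1)] that(2) r by simp
  have X1: "(\<Sum>b\<in>insert j I. B a b * X b i) = (if i < r then \<Sum>b\<in>I. B a b * u i b else B a j)" for a i
  proof -
    have "(\<Sum>b\<in>I. B a b * X b i) = (if i < r then \<Sum>b\<in>I. B a b * u i b else 0)"
      using j by (auto simp: X_def intro!: sum.cong sum.neutral)
    then show ?thesis using I j by (simp add: X_def)
  qed
  have X2: "(\<Sum>a\<in>insert j I. X a i * f a) = (if i < r then \<Sum>a\<in>I. u i a * f a else f j)" for f i
  proof -
    have "(\<Sum>a\<in>I. X a i * f a) = (if i < r then \<Sum>a\<in>I. u i a * f a else 0)"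
      using j by (auto simp: X_def intro!: sum.cong sum.neutral)
    then show ?thesis using I j by (simp add: X_def)
  qed
  have N: "(\<Sum>a\<in>insert j I. \<Sum>b\<in>insert j I. X a i * B a b * X b i') = (\<Sum>q<Suc r. d q * L q i * L q i')"
    if "i < Suc r" "i' < Suc r" for i i'
  proof -
    have hl: "(\<Sum>b\<in>I. B j b * u k b) = h k" if "k < r" for k
      unfolding h_def by (intro sum.cong refl) (simp add: sym mult.commute)
    have "(\<Sum>a\<in>insert j I. \<Sum>b\<in>insert j I. X a i * B a b * X b i')
        = (\<Sum>a\<in>insert j I. X a i * (\<Sum>b\<in>insert j I. B a b * X b i'))"
      by (simp only: sum_distrib_left mult.assoc)
    also have "\<dots> = (if i < r then if i' < r then if i = i' then l i else 0 else h i
        else if i' < r then h i' else B j j)"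
      unfolding X1 X2 using r that
      by (auto simp: BI hl h_def mult.left_commute[of _ "l _"] sum_distrib_left[symmetric] eigensystemD(2)[OF E])
    also have "\<dots> = (\<Sum>q<Suc r. d q * L q i * L q i')"
    proof (cases "i < r \<or> i' < r")
      case True
      then have "(\<Sum>q<Suc r. d q * L q i * L q i') = (\<Sum>q\<in>{if i < r then i else i'}. d q * L q i * L q i')"
        using that by (intro sum.mono_neutral_right) (auto simp: L_def split: if_splits)
      then show ?thesis using True that False by (auto simp: L_def d_def)
    next
      case F: False
      then have "i = r" "i' = r" using that by auto
      have "(\<Sum>q<r. d q * L q i * L q i') = (\<Sum>k<r. inverse (l k) * (h k)\<^sup>2)"
        using False \<open>i = r\<close> \<open>i' = r\<close> by (intro sum.cong refl) (auto simp: L_def d_def field_simps power2_eq_square)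
      then show ?thesis using \<open>i = r\<close> \<open>i' = r\<close> by (simp add: L_def d_def e_def)
    qed
    finally show ?thesis .
  qed
  have "mat (Suc r) (Suc r) (\<lambda>(i, i'). \<Sum>q<Suc r. d q * L q i * L q i')
      = mat (Suc r) (Suc r) (\<lambda>(i, i'). \<Sum>a\<in>insert j I. \<Sum>b\<in>insert j I. X a i * B a b * X b i')"
    by (intro eq_matI) (simp_all only: N dim_row_mat dim_col_mat index_mat split)
  then have "(\<Prod>q<Suc r. d q)
      = det (mat (Suc r) (Suc r) (\<lambda>(i, i'). \<Sum>a\<in>insert j I. \<Sum>b\<in>insert j I. X a i * B a b * X b i'))"
    using det_unit_triangular_congruence[of "Suc r" L d] by (simp add: L_def del: sum.lessThan_Suc prod.lessThan_Suc)
  also have "\<dots> \<le> (\<Prod>k<Suc r. m k) * det (mat (Suc r) (Suc r) (\<lambda>(i, i'). \<Sum>a\<in>insert j I. X a i * X a i'))"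
    by (rule det_compression_le[OF F])
  finally have "(\<Prod>q<Suc r. d q) \<le> (\<Prod>k<Suc r. m k)" unfolding gram by simp
  then show ?thesis by (simp add: d_def e_def h_def mult.commute)
qed

text \<open>Cutting the leading eigenvectors at \<open>i\<close> leaves the Gram determinant
  \<open>?g\<close>. The compression is bounded below through \<open>J\<close> with the factor
  \<open>?g\<^sup>2\<close> and above through \<open>J - {i}\<close> with the factor
  \<open>?g\<close>, so one \<open>?g\<close> cancels. If \<open>?g = 0\<close>, the claim is the
  nonnegativity of the volume.\<close>

lemma volume_remove_index:
  assumes E: "eigensystem J B v m" and i: "i \<in> J" and F: "eigensystem (J - {i}) B u l"
    and r: "r < card J"
  shows "(\<Prod>k<r. m k) * (1 - (\<Sum>k<r. (v k i)\<^sup>2)) \<le> (\<Prod>k<r. l k)"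
proof -
  let ?g = "1 - (\<Sum>k<r. (v k i)\<^sup>2)"
  let ?J = "J - {i}"
  have J: "finite J" using eigensystemD(1)[OF E] .
  define X where "X a k = (if a = i then 0 else v k a)" for a k
  have XJ: "(\<Sum>a\<in>J. f a * X a k) = (\<Sum>a\<in>?J. f a * X a k)" for f k
    using J i by (simp add: sum.remove[of J i] X_def)
  have ip: "(\<Sum>a\<in>?J. v k a * v q a) = (if k = q then 1 else 0) - v k i * v q i" if "k < r" "q < r" for k q
    using eigensystemD(2)[OF E, of k q] that r J i by (simp add: sum.remove[of J i])
  have g: "det (mat r r (\<lambda>(k, q). \<Sum>a\<in>?J. v k a * v q a)) = ?g"
    unfolding det_one_minus_outer_product[symmetric]
    by (intro arg_cong[where f = det] eq_matI) (auto simp: ip)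
  have g1: "det (mat r r (\<lambda>(k, q). \<Sum>a\<in>?J. X a k * X a q)) = ?g"
    unfolding g[symmetric] by (intro arg_cong[where f = det] eq_matI) (auto simp: X_def intro!: sum.cong)
  have g2: "det (mat r r (\<lambda>(k, q). \<Sum>a\<in>J. v k a * X a q)) = ?g"
    unfolding g[symmetric] XJ by (intro arg_cong[where f = det] eq_matI) (auto simp: X_def intro!: sum.cong)
  have form: "(\<Sum>a\<in>J. \<Sum>b\<in>J. X a k * B a b * X b q) = (\<Sum>a\<in>?J. \<Sum>b\<in>?J. X a k * B a b * X b q)" for k q
    unfolding XJ using J i by (simp add: sum.remove[of J i] X_def)
  have g0: "0 \<le> ?g" using det_gram_nonneg[of ?J r X] g1 J by simp
  have "(\<Prod>k<r. m k) * ?g\<^sup>2 \<le> (\<Prod>k<r. l k) * ?g"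
    using det_compression_ge[OF E, of r X] det_compression_le[OF F, of r X] r
    unfolding g1 g2 form by simp
  then have "((\<Prod>k<r. m k) * ?g) * ?g \<le> (\<Prod>k<r. l k) * ?g"
    by (simp only: power2_eq_square mult.assoc)
  moreover have "0 \<le> (\<Prod>k<r. l k)"
    using r J i by (intro prod_nonneg ballI eigensystemD(5)[OF F]) auto
  ultimately show ?thesis using g0 by (cases "?g = 0") (auto simp: mult_le_cancel_right)
qed

text \<open>The squared row norms of the leading eigenvectors are leverage scores. Exchanging the
  sums, they add up to \<open>r\<close>, as each of the \<open>r\<close> eigenvectors has unit
  norm.\<close>

lemma volume_average:
  assumes E: "eigensystem J B v m" and r: "r < card J"
    and le: "\<And>i. i \<in> J \<Longrightarrow> \<exists>u l. eigensystem (J - {i}) B u l \<and> (\<Prod>k<r. l k) \<le> V"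
  shows "(real (card J) - real r) * (\<Prod>k<r. m k) \<le> real (card J) * V"
proof -
  have "(\<Sum>i\<in>J. (\<Prod>k<r. m k) * (1 - (\<Sum>k<r. (v k i)\<^sup>2))) \<le> (\<Sum>i\<in>J. V)"
    using le volume_remove_index[OF E _ _ r] by (intro sum_mono) (meson order_trans)
  moreover have "(\<Sum>i\<in>J. (\<Sum>k<r. (v k i)\<^sup>2)) = (\<Sum>k<r. (\<Sum>i\<in>J. v k i * v k i))"
    by (subst sum.swap) (simp add: power2_eq_square)
  moreover have "\<dots> = real r" using r eigensystemD(2)[OF E] by simp
  ultimately show ?thesis
    by (simp add: sum_distrib_left[symmetric] sum_subtractf mult.commute)
qed

subsection \<open>Truncation and pseudoinverse\<close>

abbreviation entry :: "real mat \<Rightarrow> nat \<Rightarrow> nat \<Rightarrow> real" where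
  "entry A \<equiv> \<lambda>a b. A $$ (a, b)"

lemma bij_betw_pick:
  assumes "finite I"
  shows "bij_betw (pick I) {..<card I} I"
proof -
  have inj: "inj_on (pick I) {..<card I}"
    by (rule linorder_inj_onI) (auto dest: pick_mono_le[rotated])
  have "pick I ` {..<card I} = I"
    using assms inj by (intro card_subset_eq) (auto simp: pick_in_set_le card_image)
  then show ?thesis using inj by (simp add: bij_betw_def)
qed

lemma sum_pick:
  assumes "finite I"
  shows "(\<Sum>i<card I. f (pick I i)) = (\<Sum>a\<in>I. f a)"
  using sum.reindex_bij_betw[OF bij_betw_pick[OF assms]] .

lemma Collect_less_and_subset:
  assumes "I \<subseteq> {..<n}"
  shows "{i. i < n \<and> i \<in> I} = I"
  using assms by auto

lemma submatrix_square:
  assumes "W \<in> carrier_mat n n" "I \<subseteq> {..<n}"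
  shows "submatrix W I I \<in> carrier_mat (card I) (card I)"
    and "i < card I \<Longrightarrow> j < card I \<Longrightarrow> submatrix W I I $$ (i, j) = W $$ (pick I i, pick I j)"
  using assms by (auto simp: submatrix_def Collect_less_and_subset)

lemma submatrix_cols:
  assumes "W \<in> carrier_mat n n" "I \<subseteq> {..<n}"
  shows "submatrix W UNIV I \<in> carrier_mat n (card I)"
    and "i < n \<Longrightarrow> j < card I \<Longrightarrow> submatrix W UNIV I $$ (i, j) = W $$ (i, pick I j)"
  using assms by (auto simp: submatrix_def Collect_less_and_subset pick_UNIV)

lemma submatrix_rows:
  assumes "W \<in> carrier_mat n n" "I \<subseteq> {..<n}"
  shows "submatrix W I UNIV \<in> carrier_mat (card I) n"
    and "i < card I \<Longrightarrow> j < n \<Longrightarrow> submatrix W I UNIV $$ (i, j) = W $$ (pick I i, j)"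
  using assms by (auto simp: submatrix_def Collect_less_and_subset pick_UNIV)

lemma submatrix_lessThan:
  assumes "W \<in> carrier_mat n n"
  shows "submatrix W {..<n} {..<n} = W"
proof -
  have "pick {..<n} i = i" if "i < n" for i
  proof -
    have "{a \<in> {..<n}. a < i} = {..<i}" using that by auto
    then show ?thesis using pick_card_in_set[of i "{..<n}"] that by simp
  qed
  then show ?thesis using submatrix_square[OF assms, of "{..<n}"] assms by (intro eq_matI) auto
qed

text \<open>\<open>card {x \<in> I. x < a}\<close> is the position of \<open>a\<close> in
  \<open>I\<close>, the inverse of \<open>pick I\<close>; it carries the rows of \<open>P\<close>
  back to the indices of \<open>W\<close>.\<close>

lemma eigensystem_submatrix:
  assumes W: "W \<in> carrier_mat n n" and I: "I \<subseteq> {..<n}"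
    and P: "orthogonal_matrix (card I) P"
    and diag: "submatrix W I I = P * mat_diag (card I) l * P\<^sup>T"
    and nonneg: "\<And>k. k < card I \<Longrightarrow> 0 \<le> l k" and mono: "\<And>k q. k \<le> q \<Longrightarrow> q < card I \<Longrightarrow> l q \<le> l k"
  shows "eigensystem I (entry W) (\<lambda>k a. P $$ (card {x \<in> I. x < a}, k)) l"
proof -
  have fin: "finite I" using I finite_subset by blast
  have Pc: "P \<in> carrier_mat (card I) (card I)" using P by (simp add: orthogonal_matrix_def)
  have pos: "card {x \<in> I. x < a} < card I" "pick I (card {x \<in> I. x < a}) = a" if "a \<in> I" for a
    using that fin by (auto intro!: psubset_card_mono pick_card_in_set)
  have inj: "card {x \<in> I. x < a} = card {x \<in> I. x < b} \<longleftrightarrow> a = b" if "a \<in> I" "b \<in> I" for a b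
    using that pos(2) by metis
  have cols: "(\<Sum>a\<in>I. P $$ (card {x \<in> I. x < a}, k) * P $$ (card {x \<in> I. x < a}, q))
      = (if k = q then 1 else 0)" if "k < card I" "q < card I" for k q
    unfolding sum_pick[OF fin, symmetric] orthogonal_matrix_cols[OF P that, symmetric]
    by (intro sum.cong refl) (simp add: card_pick_le)
  have "W $$ (a, b) = (\<Sum>k<card I. l k * P $$ (card {x \<in> I. x < a}, k) * P $$ (card {x \<in> I. x < b}, k))"
    if "a \<in> I" "b \<in> I" for a b
  proof -
    have "W $$ (a, b) = submatrix W I I $$ (card {x \<in> I. x < a}, card {x \<in> I. x < b})"
      using pos that submatrix_square[OF W I] by simp
    then show ?thesis unfolding diag using diag_conjugation_index[OF Pc] pos(1) that by simp
  qed
  moreover have "(\<Sum>k<card I. P $$ (card {x \<in> I. x < a}, k) * P $$ (card {x \<in> I. x < b}, k))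
      = (if a = b then 1 else 0)" if "a \<in> I" "b \<in> I" for a b
    using orthogonal_matrix_rows[OF P pos(1) pos(1), OF that] inj[OF that] by simp
  ultimately show ?thesis unfolding eigensystem_def using fin cols nonneg mono by auto
qed

lemma spsd_submatrix:
  assumes W: "spsd n W" and I: "I \<subseteq> {..<n}"
  shows "spsd (card I) (submatrix W I I)"
proof -
  have Wc: "W \<in> carrier_mat n n" using W by (simp add: spsd_def)
  have fin: "finite I" using I finite_subset by blast
  note S = submatrix_square[OF Wc I]
  have pn: "pick I i < n" if "i < card I" for i using pick_in_set_le[OF that] I by auto
  have "(submatrix W I I)\<^sup>T = submatrix W I I"
    using S pn spsd_sym[OF W] by (intro eq_matI) auto
  moreover have "0 \<le> x \<bullet> (submatrix W I I *\<^sub>v x)" if x: "x \<in> carrier_vec (card I)" for x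
  proof -
    define y where "y a = (if a \<in> I then x $ card {b \<in> I. b < a} else 0)" for a
    have y: "y (pick I i) = x $ i" if "i < card I" for i
      using that by (simp add: y_def pick_in_set_le card_pick_le)
    have "x \<bullet> (submatrix W I I *\<^sub>v x)
        = (\<Sum>i<card I. \<Sum>j<card I. x $ i * submatrix W I I $$ (i, j) * x $ j)"
      using x S(1) by (auto simp: scalar_prod_def atLeast0LessThan sum_distrib_left mult.assoc
          intro!: sum.cong)
    also have "\<dots> = (\<Sum>i<card I. \<Sum>j<card I. y (pick I i) * W $$ (pick I i, pick I j) * y (pick I j))"
      by (intro sum.cong refl) (simp add: S y)
    also have "\<dots> = (\<Sum>a\<in>I. \<Sum>b\<in>I. y a * W $$ (a, b) * y b)"
      unfolding sum_pick[OF fin, of "\<lambda>b. y _ * W $$ (_, b) * y b"]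
      by (rule sum_pick[OF fin, of "\<lambda>a. \<Sum>b\<in>I. y a * W $$ (a, b) * y b"])
    also have "\<dots> = (\<Sum>a<n. \<Sum>b<n. y a * W $$ (a, b) * y b)"
    proof (rule sum.mono_neutral_cong_left[OF _ I])
      fix a show "(\<Sum>b\<in>I. y a * W $$ (a, b) * y b) = (\<Sum>b<n. y a * W $$ (a, b) * y b)"
        by (rule sum.mono_neutral_left[OF _ I]) (auto simp: y_def)
    qed (auto simp: y_def)
    finally show ?thesis using spsd_quadratic_form[OF W, of y] by simp
  qed
  ultimately show ?thesis using S(1) by (simp add: spsd_def)
qed

lemma spsd_eigensystem:
  assumes W: "spsd n W" and I: "I \<subseteq> {..<n}"
  obtains u where "eigensystem I (entry W) u (\<lambda>k. sigma (Suc k) (submatrix W I I))"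
proof (rule spsd_diagonalization[OF spsd_submatrix[OF W I]])
  have Wc: "W \<in> carrier_mat n n" using W by (simp add: spsd_def)
  fix P
  assume "orthogonal_matrix (card I) P"
    "submatrix W I I = P * mat_diag (card I) (\<lambda>k. sigma (Suc k) (submatrix W I I)) * P\<^sup>T"
    "\<And>k. k < card I \<Longrightarrow> 0 \<le> sigma (Suc k) (submatrix W I I)"
    "\<And>k q. k \<le> q \<Longrightarrow> q < card I \<Longrightarrow> sigma (Suc q) (submatrix W I I) \<le> sigma (Suc k) (submatrix W I I)"
  then show thesis by (rule that[OF eigensystem_submatrix[OF Wc I]])
qed

lemma spsd_eigensystem_full:
  assumes "spsd n W"
  obtains u where "eigensystem {..<n} (entry W) u (\<lambda>k. sigma (Suc k) W)"
  using spsd_eigensystem[OF assms order_refl] submatrix_lessThan[of W n] assms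
  by (auto simp: spsd_def)

text \<open>Singular vectors for a positive singular value \<open>s\<close> satisfy \<open>A q = s p\<close> and \<open>A p = s q\<close>, hence
  \<open>A (p - q) = - s (p - q)\<close>, which forces \<open>p = q\<close> by semidefiniteness.\<close>

lemma spsd_singular_vectors_eq:
  assumes A: "spsd n A" and P: "orthogonal_matrix n P" and Q: "orthogonal_matrix n Q"
    and svd: "A = P * mat_diag n s * Q\<^sup>T" and k: "k < n" "0 < s k" and a: "a < n"
  shows "P $$ (a, k) = Q $$ (a, k)"
proof -
  have Pc: "P \<in> carrier_mat n n" and Qc: "Q \<in> carrier_mat n n"
    using P Q by (auto simp: orthogonal_matrix_def)
  have Aij: "A $$ (i, j) = (\<Sum>q<n. s q * P $$ (i, q) * Q $$ (j, q))" if "i < n" "j < n" for i j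
  proof -
    have "A $$ (i, j) = (\<Sum>q<n. P $$ (i, q) * s q * Q $$ (j, q))"
      unfolding svd mat_diag_mult_right[OF Pc] using Qc that
      by (simp add: scalar_prod_def atLeast0LessThan)
    then show ?thesis by (simp only: mult.commute[of "P $$ (i, _)"])
  qed
  have AQ: "(\<Sum>b<n. A $$ (i, b) * Q $$ (b, k)) = s k * P $$ (i, k)" if i: "i < n" for i
  proof -
    have "(\<Sum>b<n. A $$ (i, b) * Q $$ (b, k)) = (\<Sum>b<n. \<Sum>q<n. s q * P $$ (i, q) * (Q $$ (b, q) * Q $$ (b, k)))"
      using i by (intro sum.cong refl) (simp add: Aij sum_distrib_right mult.assoc)
    also have "\<dots> = (\<Sum>q<n. s q * P $$ (i, q) * (\<Sum>b<n. Q $$ (b, q) * Q $$ (b, k)))"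
      by (subst sum.swap) (simp add: sum_distrib_left)
    also have "\<dots> = (\<Sum>q<n. if q = k then s k * P $$ (i, k) else 0)"
      using k by (intro sum.cong refl) (simp add: orthogonal_matrix_cols[OF Q])
    finally show ?thesis using k by simp
  qed
  have AP: "(\<Sum>b<n. A $$ (i, b) * P $$ (b, k)) = s k * Q $$ (i, k)" if i: "i < n" for i
  proof -
    have "A $$ (i, b) * P $$ (b, k) = (\<Sum>q<n. s q * Q $$ (i, q) * (P $$ (b, q) * P $$ (b, k)))"
      if "b < n" for b
      unfolding spsd_sym[OF A i that] Aij[OF that i] sum_distrib_right
      by (intro sum.cong refl) (simp only: mult_ac)
    then have "(\<Sum>b<n. A $$ (i, b) * P $$ (b, k)) = (\<Sum>b<n. \<Sum>q<n. s q * Q $$ (i, q) * (P $$ (b, q) * P $$ (b, k)))"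
      by (intro sum.cong refl) simp
    also have "\<dots> = (\<Sum>q<n. s q * Q $$ (i, q) * (\<Sum>b<n. P $$ (b, q) * P $$ (b, k)))"
      by (subst sum.swap) (simp add: sum_distrib_left)
    also have "\<dots> = (\<Sum>q<n. if q = k then s k * Q $$ (i, k) else 0)"
      using k by (intro sum.cong refl) (simp add: orthogonal_matrix_cols[OF P])
    finally show ?thesis using k by simp
  qed
  define x where "x i = P $$ (i, k) - Q $$ (i, k)" for i
  have "0 \<le> (\<Sum>i<n. \<Sum>b<n. x i * A $$ (i, b) * x b)" by (rule spsd_quadratic_form[OF A])
  also have "\<dots> = (\<Sum>i<n. x i * ((\<Sum>b<n. A $$ (i, b) * P $$ (b, k)) - (\<Sum>b<n. A $$ (i, b) * Q $$ (b, k))))"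
    by (simp only: x_def right_diff_distrib sum_subtractf[symmetric] sum_distrib_left mult.assoc)
  also have "\<dots> = - s k * (\<Sum>i<n. (x i)\<^sup>2)"
    by (simp add: AP AQ sum_distrib_left, intro sum.cong refl)
      (simp add: x_def power2_eq_square algebra_simps)
  finally have "(\<Sum>i<n. (x i)\<^sup>2) \<le> 0" using k(2) by (simp add: mult_le_0_iff)
  then have "(\<Sum>i<n. (x i)\<^sup>2) = 0" by (intro antisym sum_nonneg) auto
  then have "x a = 0" using a by (simp add: sum_nonneg_eq_0_iff)
  then show ?thesis by (simp add: x_def)
qed

text \<open>\<open>P\<close> and \<open>Q\<close> can differ only in columns whose singular value is
  0, and these enter with weight 0. So \<open>Q\<close> may be replaced by \<open>P\<close>, and
  every admissible truncation, also in the case of ties, is a spectral one.\<close>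

lemma rank_truncation_spsd:
  assumes A: "spsd n A" and T: "rank_truncation r A T"
  obtains P where "orthogonal_matrix n P" "A = P * mat_diag n (\<lambda>k. sigma (Suc k) A) * P\<^sup>T"
    "T = P * mat_diag n (\<lambda>k. if k < r then sigma (Suc k) A else 0) * P\<^sup>T"
proof -
  have Ac: "A \<in> carrier_mat n n" using A by (simp add: spsd_def)
  let ?s = "\<lambda>r k. if k < r then sigma (Suc k) A else 0"
  have smat: "sigma_mat r A = mat_diag n (?s r)" for r
    using Ac by (intro eq_matI) (auto simp: sigma_mat_def mat_diag_def)
  obtain P Q where P: "orthogonal_matrix n P" and Q: "orthogonal_matrix n Q"
    and svd: "A = P * mat_diag n (?s n) * Q\<^sup>T" and TQ: "T = P * mat_diag n (?s r) * Q\<^sup>T"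
    using T Ac unfolding rank_truncation_def smat by auto
  have c: "P \<in> carrier_mat n n" "Q \<in> carrier_mat n n" using P Q by (auto simp: orthogonal_matrix_def)
  have PQ: "P * mat_diag n (?s r) * Q\<^sup>T = P * mat_diag n (?s r) * P\<^sup>T" for r
  proof (rule eq_matI)
    fix i j assume "i < dim_row (P * mat_diag n (?s r) * P\<^sup>T)" "j < dim_col (P * mat_diag n (?s r) * P\<^sup>T)"
    then have ij: "i < n" "j < n" using c by auto
    have eq: "P $$ (i, k) * ?s r k * Q $$ (j, k) = P $$ (i, k) * ?s r k * P $$ (j, k)" if "k < n" for k
      using spsd_singular_vectors_eq[OF A P Q svd that _ ij(2)] sigma_nonneg[OF A, of "Suc k"] that
      by (cases "sigma (Suc k) A = 0") auto
    show "(P * mat_diag n (?s r) * Q\<^sup>T) $$ (i, j) = (P * mat_diag n (?s r) * P\<^sup>T) $$ (i, j)"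
      unfolding mat_diag_mult_right[OF c(1)] using c ij
      by (simp add: scalar_prod_def atLeast0LessThan, intro sum.cong refl, simp only: lessThan_iff eq)
  qed (use c in auto)
  have eq: "mat_diag n (?s n) = mat_diag n (\<lambda>k. sigma (Suc k) A)"
    by (intro eq_matI) (auto simp: mat_diag_def)
  show ?thesis by (rule that[OF P svd[unfolded PQ, unfolded eq] TQ[unfolded PQ]])
qed

section \<open>The Moore--Penrose pseudoinverse\<close>

text \<open>Penrose's argument: M X = (M Y)(M X), and transposition swaps the two symmetric factors,
  so that M X = M X M Y = M Y. Likewise X M = Y M, and X = X M X = X M Y = Y.\<close>

lemma is_pinv_unique:
  fixes M :: "real mat"
  assumes M: "M \<in> carrier_mat n n" and X: "is_pinv M X" and Y: "is_pinv M Y"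
  shows "X = Y"
proof -
  have c: "X \<in> carrier_mat n n" "Y \<in> carrier_mat n n" using M X Y by (auto simp: is_pinv_def)
  note assoc = assoc_mult_mat[of _ n n _ n _ n] mult_carrier_mat[of _ n n _ n]
  have "M * X = (M * Y * M * X)\<^sup>T"
    using X Y by (simp add: is_pinv_def)
  also have "\<dots> = ((M * Y) * (M * X))\<^sup>T" using M c by (simp add: assoc)
  also have "\<dots> = (M * X) * (M * Y)"
    using X Y M c by (subst transpose_mult[of _ n n _ n]) (auto simp: is_pinv_def)
  also have "\<dots> = (M * X * M) * Y" using M c by (simp add: assoc)
  finally have MX: "M * X = M * Y" using X by (simp add: is_pinv_def)
  have "X * M = (X * (M * Y * M))\<^sup>T"
    using X Y by (simp add: is_pinv_def)
  also have "\<dots> = ((X * M) * (Y * M))\<^sup>T" using M c by (simp add: assoc)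
  also have "\<dots> = (Y * M) * (X * M)"
    using X Y M c by (subst transpose_mult[of _ n n _ n]) (auto simp: is_pinv_def)
  also have "\<dots> = Y * (M * X * M)" using M c by (simp add: assoc)
  finally have XM: "X * M = Y * M" using X by (simp add: is_pinv_def)
  have "X = X * (M * X)" using X M c by (simp add: is_pinv_def assoc)
  also have "\<dots> = (X * M) * Y" unfolding MX using M c by (simp add: assoc)
  also have "\<dots> = Y" unfolding XM using Y by (simp add: is_pinv_def)
  finally show ?thesis .
qed

text \<open>The convention \<open>inverse 0 = 0\<close> is exactly what the Penrose equations
  require at vanishing diagonal entries.\<close>

lemma pinv_diagonalized:
  assumes P: "orthogonal_matrix n P" and M: "M = P * mat_diag n d * P\<^sup>T"
  shows "pinv M = P * mat_diag n (\<lambda>k. inverse (d k)) * P\<^sup>T"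
proof -
  let ?X = "P * mat_diag n (\<lambda>k. inverse (d k)) * P\<^sup>T"
  have Pc: "P \<in> carrier_mat n n" and PP: "P\<^sup>T * P = 1\<^sub>m n" using P by (auto simp: orthogonal_matrix_def)
  note assoc = assoc_mult_mat[of _ n n _ n _ n] mult_carrier_mat[of _ n n _ n]
  have prod: "(P * mat_diag n f * P\<^sup>T) * (P * mat_diag n g * P\<^sup>T) = P * mat_diag n (\<lambda>k. f k * g k) * P\<^sup>T" for f g
  proof -
    have "(P * mat_diag n f * P\<^sup>T) * (P * mat_diag n g * P\<^sup>T)
        = P * (mat_diag n f * ((P\<^sup>T * P) * mat_diag n g)) * P\<^sup>T"
      using Pc by (simp add: assoc)
    then show ?thesis unfolding PP by (simp add: left_mult_one_mat[of _ n n])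
  qed
  have sym: "(P * mat_diag n f * P\<^sup>T)\<^sup>T = P * mat_diag n f * P\<^sup>T" for f
    using Pc by (subst transpose_mult3[of _ n]) (auto simp: transpose_mat_diag assoc)
  have inv: "d k * inverse (d k) * d k = d k" "inverse (d k) * d k * inverse (d k) = inverse (d k)" for k
    by (cases "d k = 0"; simp)+
  have Mc: "M \<in> carrier_mat n n" unfolding M using Pc by (simp add: assoc)
  have X: "is_pinv M ?X"
    unfolding is_pinv_def using Mc Pc by (simp add: M prod sym inv assoc(2))
  show ?thesis unfolding pinv_def
    by (rule the_equality) (auto intro: X is_pinv_unique[OF Mc _ X])
qed

subsection \<open>Truncation error and complete pivoting\<close>

text \<open>With \<open>B\<close> a Gram matrix of vectors \<open>w a\<close>, the truncation error is the Gram matrix of the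
  projections of the \<open>w a\<close> along the vectors \<open>z k = (\<Sum>c\<in>I. u k c * w c)\<close>, so its largest entry
  lies on the diagonal.\<close>

lemma truncation_error_abs_le:
  assumes F: "eigensystem N B v m" and E: "eigensystem I B u l" and IN: "I \<subseteq> N" and r: "r \<le> card I"
    and diag: "\<And>a. a \<in> N \<Longrightarrow> B a a - (\<Sum>k<r. inverse (l k) * (\<Sum>c\<in>I. u k c * B c a)\<^sup>2) \<le> M"
    and a: "a \<in> N" and b: "b \<in> N"
  shows "\<bar>B a b - (\<Sum>k<r. inverse (l k) * (\<Sum>c\<in>I. u k c * B c a) * (\<Sum>c\<in>I. u k c * B c b))\<bar> \<le> M"
proof -
  let ?n = "card N"
  define w where "w a q = sqrt (m q) * v q a" for a q
  define h where "h k a = (\<Sum>c\<in>I. u k c * B c a)" for k a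
  define z where "z k q = (\<Sum>c\<in>I. u k c * w c q)" for k q
  define y where "y a q = w a q - (\<Sum>k<r. inverse (l k) * h k a * z k q)" for a q
  have B: "B a b = (\<Sum>q<?n. w a q * w b q)" if "a \<in> N" "b \<in> N" for a b
    unfolding eigensystemD(4)[OF F that] using eigensystemD(5)[OF F]
    by (intro sum.cong refl) (simp add: w_def)
  have zf: "(\<Sum>q<?n. z k q * f q) = (\<Sum>c\<in>I. u k c * (\<Sum>q<?n. w c q * f q))" for k f
    unfolding z_def sum_distrib_right sum_distrib_left by (subst sum.swap) (simp only: mult.assoc)
  have zw: "(\<Sum>q<?n. z k q * w a q) = h k a" if "a \<in> N" for k a
    unfolding zf h_def using that IN by (intro sum.cong refl) (auto simp: B)
  \<comment> \<open>The \<open>z k\<close> are orthogonal with squared norm \<open>l k\<close>,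
    which makes \<open>y a\<close> the residual of an orthogonal projection.\<close>
  have zz: "(\<Sum>q<?n. z k q * z k' q) = (if k = k' then l k else 0)" if k: "k < r" "k' < r" for k k'
  proof -
    have "(\<Sum>q<?n. w c q * z k' q) = l k' * u k' c" if c: "c \<in> I" for c
    proof -
      have "(\<Sum>q<?n. w c q * z k' q) = (\<Sum>q<?n. z k' q * w c q)" by (simp only: mult.commute)
      also have "\<dots> = (\<Sum>d\<in>I. B c d * u k' d)"
        using c IN by (subst zw) (auto simp: h_def mult.commute eigensystem_sym[OF E c] intro!: sum.cong)
      finally show ?thesis using eigensystem_eigenvector[OF E c, of k'] k r by simp
    qed
    then have "(\<Sum>q<?n. z k q * z k' q) = l k' * (\<Sum>c\<in>I. u k c * u k' c)"
      unfolding zf sum_distrib_left[of "l k'"] by (intro sum.cong refl) simp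
    then show ?thesis using eigensystemD(2)[OF E, of k k'] k r by simp
  qed
  have zy: "(\<Sum>q<?n. z k q * y b q) = h k b - inverse (l k) * h k b * l k" if k: "k < r" and b: "b \<in> N" for k b
  proof -
    have "(\<Sum>q<?n. z k q * y b q) = h k b - (\<Sum>q<?n. \<Sum>k'<r. inverse (l k') * h k' b * (z k q * z k' q))"
      unfolding y_def right_diff_distrib sum_subtractf zw[OF b] sum_distrib_left
      by (simp only: mult.left_commute mult.assoc)
    also have "(\<Sum>q<?n. \<Sum>k'<r. inverse (l k') * h k' b * (z k q * z k' q))
        = (\<Sum>k'<r. inverse (l k') * h k' b * (\<Sum>q<?n. z k q * z k' q))"
      by (subst sum.swap) (simp only: sum_distrib_left)
    also have "\<dots> = (\<Sum>k'<r. if k' = k then inverse (l k) * h k b * l k else 0)"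
      using k by (intro sum.cong refl) (simp add: zz)
    finally show ?thesis using k by simp
  qed
  have yy: "(\<Sum>q<?n. y a q * y b q) = B a b - (\<Sum>k<r. inverse (l k) * h k a * h k b)"
    if ab: "a \<in> N" "b \<in> N" for a b
  proof -
    have "(\<Sum>q<?n. y a q * y b q)
        = (\<Sum>q<?n. w a q * y b q) - (\<Sum>q<?n. \<Sum>k<r. inverse (l k) * h k a * (z k q * y b q))"
      unfolding sum_subtractf[symmetric]
      by (intro sum.cong refl) (simp add: y_def[of a] left_diff_distrib sum_distrib_right mult.assoc)
    also have "(\<Sum>q<?n. \<Sum>k<r. inverse (l k) * h k a * (z k q * y b q))
        = (\<Sum>k<r. inverse (l k) * h k a * (\<Sum>q<?n. z k q * y b q))"
      by (subst sum.swap) (simp only: sum_distrib_left)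
    \<comment> \<open>For \<open>l k \<noteq> 0\<close> the residual is orthogonal to
      \<open>z k\<close>; for \<open>l k = 0\<close> the coefficient \<open>inverse (l k)\<close> is
      0.\<close>
    also have "\<dots> = 0"
    proof (intro sum.neutral ballI)
      fix k assume k: "k \<in> {..<r}"
      then show "inverse (l k) * h k a * (\<Sum>q<?n. z k q * y b q) = 0"
        by (cases "l k = 0") (simp_all add: zy[OF _ ab(2)])
    qed
    also have "(\<Sum>q<?n. w a q * y b q)
        = B a b - (\<Sum>q<?n. \<Sum>k<r. inverse (l k) * h k b * (z k q * w a q))"
      unfolding B[OF ab] sum_subtractf[symmetric]
      by (intro sum.cong refl) (simp add: y_def[of b] right_diff_distrib sum_distrib_left mult_ac)
    also have "(\<Sum>q<?n. \<Sum>k<r. inverse (l k) * h k b * (z k q * w a q))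
        = (\<Sum>k<r. inverse (l k) * h k a * h k b)"
      by (subst sum.swap, intro sum.cong refl)
        (simp only: sum_distrib_left[symmetric] zw[OF ab(1)], simp only: mult_ac)
    finally show ?thesis by simp
  qed
  have M: "(\<Sum>q<?n. y a q * y a q) \<le> M" if "a \<in> N" for a
    using diag[OF that] unfolding yy[OF that that] by (simp add: h_def power2_eq_square mult.assoc)
  have "2 * \<bar>y a q * y b q\<bar> \<le> y a q * y a q + y b q * y b q" for q
    using sum_squares_bound[of "\<bar>y a q\<bar>" "\<bar>y b q\<bar>"] by (simp add: abs_mult power2_eq_square)
  then have "(\<Sum>q<?n. 2 * \<bar>y a q * y b q\<bar>) \<le> (\<Sum>q<?n. y a q * y a q + y b q * y b q)"
    by (intro sum_mono)
  then have "2 * (\<Sum>q<?n. \<bar>y a q * y b q\<bar>) \<le> 2 * M"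
    using M[OF a] M[OF b] by (simp add: sum.distrib sum_distrib_left[symmetric])
  moreover have "\<bar>\<Sum>q<?n. y a q * y b q\<bar> \<le> (\<Sum>q<?n. \<bar>y a q * y b q\<bar>)" by (rule sum_abs)
  ultimately show ?thesis unfolding yy[OF a b] h_def by simp
qed

text \<open>On \<open>I\<close> the subtracted sum consists of the \<open>r\<close> leading spectral
  terms. The tail has weights at most \<open>l r\<close>, and the squares of the
  \<open>u k a\<close> add up to 1 over \<open>k\<close>.\<close>

lemma truncation_error_inside_le:
  assumes E: "eigensystem I B u l" and r: "r < card I" and a: "a \<in> I"
  shows "B a a - (\<Sum>k<r. inverse (l k) * (\<Sum>c\<in>I. u k c * B c a)\<^sup>2) \<le> l r"
proof -
  let ?K = "card I"
  have "(\<Sum>c\<in>I. u k c * B c a) = l k * u k a" if "k < r" for k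
    using eigensystem_eigenvector[OF E a, of k] that r eigensystem_sym[OF E a]
    by (simp add: mult.commute cong: sum.cong)
  then have "(\<Sum>k<r. inverse (l k) * (\<Sum>c\<in>I. u k c * B c a)\<^sup>2) = (\<Sum>k<r. l k * (u k a)\<^sup>2)"
    by (intro sum.cong refl) (auto simp: power2_eq_square)
  also have "\<dots> = (\<Sum>k<?K. if k < r then l k * (u k a)\<^sup>2 else 0)"
    using r by (intro sum.mono_neutral_cong_left) auto
  also have "B a a - \<dots> = (\<Sum>k<?K. if k < r then 0 else l k * (u k a)\<^sup>2)"
    unfolding eigensystemD(4)[OF E a a] sum_subtractf[symmetric]
    by (intro sum.cong refl) (auto simp: power2_eq_square)
  also have "\<dots> \<le> (\<Sum>k<?K. l r * (u k a * u k a))"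
    using eigensystemD(5,6)[OF E] r
    by (intro sum_mono) (auto simp: power2_eq_square intro: mult_right_mono)
  also have "\<dots> = l r"
    unfolding sum_distrib_left[symmetric] eigensystemD(3)[OF E a a] by simp
  finally show ?thesis .
qed

section \<open>Semidefinite residuals of complete pivoting\<close>

lemma spsd_entry_abs_le:
  assumes R: "spsd n R" and ab: "a < n" "b < n"
  shows "0 \<le> R $$ (a, a)" "2 * \<bar>R $$ (a, b)\<bar> \<le> R $$ (a, a) + R $$ (b, b)"
proof -
  obtain v where E: "eigensystem {..<n} (entry R) v (\<lambda>k. sigma (Suc k) R)"
    using spsd_eigensystem_full[OF R] .
  let ?m = "\<lambda>k. sigma (Suc k) R"
  have e: "R $$ (a, b) = (\<Sum>k<n. ?m k * v k a * v k b)" if "a < n" "b < n" for a b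
    using eigensystemD(4)[OF E, of a b] that by simp
  have m: "0 \<le> ?m k" for k by (rule sigma_nonneg[OF R])
  show "0 \<le> R $$ (a, a)" unfolding e[OF ab(1) ab(1)] by (intro sum_nonneg) (simp add: m mult.assoc)
  have "0 \<le> (\<Sum>k<n. ?m k * (v k a + v k b)\<^sup>2)" "0 \<le> (\<Sum>k<n. ?m k * (v k a - v k b)\<^sup>2)"
    by (intro sum_nonneg mult_nonneg_nonneg m zero_le_power2)+
  moreover have "(\<Sum>k<n. ?m k * (v k a + v k b)\<^sup>2) = R $$ (a, a) + 2 * R $$ (a, b) + R $$ (b, b)"
    using ab unfolding e[OF ab(1) ab(1)] e[OF ab] e[OF ab(2) ab(2)] sum_distrib_left sum.distrib[symmetric]
    by (intro sum.cong refl) (simp add: power2_eq_square algebra_simps)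
  moreover have "(\<Sum>k<n. ?m k * (v k a - v k b)\<^sup>2) = R $$ (a, a) - 2 * R $$ (a, b) + R $$ (b, b)"
    using ab unfolding e[OF ab(1) ab(1)] e[OF ab] e[OF ab(2) ab(2)] sum_distrib_left sum.distrib[symmetric]
      sum_subtractf[symmetric]
    by (intro sum.cong refl) (simp add: power2_eq_square algebra_simps)
  ultimately show "2 * \<bar>R $$ (a, b)\<bar> \<le> R $$ (a, a) + R $$ (b, b)" by linarith
qed

text \<open>Every entry is at most the largest diagonal one in modulus. Splitting each product of
  coordinates by the inequality of means costs the factor \<open>n\<close>, which is the origin of
  the power of \<open>n\<close> in the volume bound for GECP.\<close>

lemma spsd_form_le:
  assumes R: "spsd n R" and M: "\<And>a. a < n \<Longrightarrow> R $$ (a, a) \<le> M"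
  shows "(\<Sum>a<n. \<Sum>b<n. x a * R $$ (a, b) * x b) \<le> real n * M * (\<Sum>a<n. x a * x a)"
proof -
  have "x a * R $$ (a, b) * x b \<le> M * ((x a * x a + x b * x b) / 2)" if "a < n" "b < n" for a b
  proof -
    have M0: "0 \<le> M" and Rab: "\<bar>R $$ (a, b)\<bar> \<le> M"
      using spsd_entry_abs_le[OF R that] M[OF that(1)] M[OF that(2)] by linarith+
    have "x a * R $$ (a, b) * x b \<le> \<bar>R $$ (a, b)\<bar> * \<bar>x a * x b\<bar>"
      unfolding abs_mult[symmetric] by (rule order_trans[OF abs_ge_self]) (simp add: mult_ac)
    also have "\<dots> \<le> M * ((x a * x a + x b * x b) / 2)"
      using sum_squares_bound[of "\<bar>x a\<bar>" "\<bar>x b\<bar>"] M0 Rab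
      by (intro mult_mono) (auto simp: abs_mult power2_eq_square)
    finally show ?thesis .
  qed
  then have "(\<Sum>a<n. \<Sum>b<n. x a * R $$ (a, b) * x b)
      \<le> (\<Sum>a<n. \<Sum>b<n. M * ((x a * x a + x b * x b) / 2))"
    by (intro sum_mono) auto
  also have "\<dots> = M / 2 * ((\<Sum>a<n. \<Sum>b<n. x a * x a) + (\<Sum>a<n. \<Sum>b<n. x b * x b))"
    by (simp only: sum.distrib[symmetric] sum_distrib_left) (simp add: field_simps)
  also have "\<dots> = real n * M * (\<Sum>a<n. x a * x a)"
    by (simp add: sum_distrib_left[symmetric])
  finally show ?thesis .
qed

text \<open>The form of the complement at \<open>x\<close> is the form of \<open>R\<close> at
  \<open>y\<close>, which changes only coordinate \<open>i\<close> of \<open>x\<close>; for a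
  nonzero pivot this change minimizes the form. For a zero pivot \<open>inverse 0 = 0\<close> gives
  \<open>y = x\<close>.\<close>

lemma spsd_schur_complement:
  assumes R: "spsd n R" and i: "i < n"
  shows "spsd n (mat n n (\<lambda>(a, b). R $$ (a, b) - R $$ (a, i) * inverse (R $$ (i, i)) * R $$ (i, b)))"
    (is "spsd n ?S")
proof -
  let ?c = "inverse (R $$ (i, i))"
  have "?S\<^sup>T = ?S"
    using spsd_sym[OF R] i by (intro eq_matI) (auto simp: mult_ac)
  moreover have "0 \<le> x \<bullet> (?S *\<^sub>v x)" if x: "x \<in> carrier_vec n" for x
  proof -
    define g where "g = (\<Sum>b<n. R $$ (i, b) * x $ b)"
    have g': "(\<Sum>a<n. x $ a * R $$ (a, i)) = g"
      unfolding g_def using spsd_sym[OF R _ i] by (intro sum.cong refl) (simp add: mult.commute)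
    have inv: "?c * ?c * R $$ (i, i) = ?c" by (cases "R $$ (i, i) = 0") auto
    define y where "y a = x $ a - (if a = i then ?c * g else 0)" for a
    have in1: "(\<Sum>b<n. R $$ (a, b) * y b) = (\<Sum>b<n. R $$ (a, b) * x $ b) - R $$ (a, i) * (?c * g)" for a
      using i by (simp add: y_def right_diff_distrib sum_subtractf if_distrib[of "\<lambda>t. _ * t"] cong: if_cong)
    have in2: "(\<Sum>a<n. y a * f a) = (\<Sum>a<n. x $ a * f a) - ?c * g * f i" for f
      using i by (simp add: y_def left_diff_distrib sum_subtractf if_distrib[of "\<lambda>t. t * _"] cong: if_cong)
    have "(\<Sum>a<n. \<Sum>b<n. y a * R $$ (a, b) * y b) = (\<Sum>a<n. y a * (\<Sum>b<n. R $$ (a, b) * y b))"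
      by (simp only: sum_distrib_left mult.assoc)
    also have "\<dots> = (\<Sum>a<n. x $ a * (\<Sum>b<n. R $$ (a, b) * x $ b)) - (\<Sum>a<n. x $ a * R $$ (a, i)) * (?c * g)
        - ?c * g * (g - R $$ (i, i) * (?c * g))"
      unfolding in1 in2 by (simp add: g_def right_diff_distrib sum_subtractf sum_distrib_right mult.assoc)
    also have "?c * g * (g - R $$ (i, i) * (?c * g)) = ?c * g * g - (?c * ?c * R $$ (i, i)) * g * g"
      by (simp add: algebra_simps)
    finally have y: "(\<Sum>a<n. \<Sum>b<n. y a * R $$ (a, b) * y b)
        = (\<Sum>a<n. x $ a * (\<Sum>b<n. R $$ (a, b) * x $ b)) - g * (?c * g)"
      unfolding inv g' by simp
    have "x \<bullet> (?S *\<^sub>v x) = (\<Sum>a<n. x $ a * (\<Sum>b<n. (R $$ (a, b) - R $$ (a, i) * ?c * R $$ (i, b)) * x $ b))"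
      using x by (simp add: scalar_prod_def atLeast0LessThan)
    also have "\<dots> = (\<Sum>a<n. x $ a * (\<Sum>b<n. R $$ (a, b) * x $ b) - x $ a * R $$ (a, i) * (?c * g))"
      unfolding g_def
      by (intro sum.cong refl)
        (simp add: left_diff_distrib sum_subtractf right_diff_distrib sum_distrib_left mult_ac)
    also have "\<dots> = (\<Sum>a<n. \<Sum>b<n. y a * R $$ (a, b) * y b)"
      unfolding y sum_subtractf sum_distrib_right[symmetric] g' ..
    finally show ?thesis using spsd_quadratic_form[OF R, of y] by simp
  qed
  ultimately show ?thesis unfolding spsd_def by simp
qed

text \<open>After \<open>t\<close> steps \<open>A\<close> differs from the residual by a matrix of rank at most \<open>t\<close>, so \<open>\<sigma>\<^sub>t\<^sub>+\<^sub>1(A)\<close> is at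
  most the norm of the residual, hence at most \<open>n\<close> times the next pivot.\<close>

lemma gecp_decomposition:
  assumes "gecp A t I R" and A: "spsd n A"
  shows "I \<subseteq> {..<n} \<and> card I = t \<and> spsd n R \<and>
    (\<exists>idx p l. bij_betw idx {..<t} I \<and>
      (\<forall>a<n. \<forall>b<n. A $$ (a, b) = R $$ (a, b) + (\<Sum>s<t. p s * l s a * l s b)) \<and>
      (\<forall>s<t. l s (idx s) = 1) \<and> (\<forall>s<t. \<forall>q<s. l s (idx q) = 0) \<and>
      (\<forall>s<t. \<forall>a<n. R $$ (a, idx s) = 0) \<and>
      (\<forall>s<t. 0 \<le> p s \<and> sigma (Suc s) A \<le> real n * p s))"
  using assms(1)
proof induction
  case start
  show ?case using A by (simp add: bij_betw_def)
next
  case (step t I R i)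
  have Ac: "A \<in> carrier_mat n n" using A by (simp add: spsd_def)
  then have dim: "dim_row A = n" "dim_col A = n" by auto
  obtain idx p l where I: "I \<subseteq> {..<n}" "card I = t" and R: "spsd n R"
    and idx: "bij_betw idx {..<t} I"
    and dec: "\<And>a b. a < n \<Longrightarrow> b < n \<Longrightarrow> A $$ (a, b) = R $$ (a, b) + (\<Sum>s<t. p s * l s a * l s b)"
    and l1: "\<And>s. s < t \<Longrightarrow> l s (idx s) = 1" and l0: "\<And>s q. s < t \<Longrightarrow> q < s \<Longrightarrow> l s (idx q) = 0"
    and R0: "\<And>s a. s < t \<Longrightarrow> a < n \<Longrightarrow> R $$ (a, idx s) = 0"
    and p: "\<And>s. s < t \<Longrightarrow> 0 \<le> p s \<and> sigma (Suc s) A \<le> real n * p s"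
    using step.IH by auto
  have i: "i < n" "i \<notin> I" using step.hyps dim by auto
  have fin: "finite I" using I(1) finite_subset by blast
  have pivot: "R $$ (a, a) \<le> R $$ (i, i)" if "a < n" for a
    using step.hyps(4) spsd_entry_abs_le(1)[OF R that that] spsd_entry_abs_le(1)[OF R i(1) i(1)] that dim
    by auto
  have idx_n: "idx s < n" "idx s \<noteq> i" if "s < t" for s
    using bij_betwE[OF idx] I(1) i(2) that by auto
  let ?d = "R $$ (i, i)"
  let ?S = "mat n n (\<lambda>(a, b). R $$ (a, b) - R $$ (a, i) * inverse ?d * R $$ (i, b))"
  \<comment> \<open>The entry at \<open>i\<close> is set to 1 even if the pivot is 0, so that the
    factor remains unit triangular after the rank is exhausted.\<close>
  let ?l = "l(t := \<lambda>a. if a = i then 1 else R $$ (a, i) / ?d)"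
  let ?p = "p(t := ?d)" and ?idx = "idx(t := i)"
  \<comment> \<open>If the largest diagonal entry of a semidefinite matrix is 0, the matrix
    vanishes.\<close>
  have zero: "R $$ (a, b) = 0" if "?d = 0" "a < n" "b < n" for a b
    using spsd_entry_abs_le[OF R that(2,3)] spsd_entry_abs_le[OF R that(3,2)]
      pivot[OF that(2)] pivot[OF that(3)] that(1) by auto
  have "bij_betw ?idx {..<t} I"
    using idx by (subst bij_betw_cong[of _ _ idx]) auto
  then have bij: "bij_betw ?idx {..<Suc t} (insert i I)"
    using notIn_Un_bij_betw[of t "{..<t}" ?idx I] i(2) by (simp add: lessThan_Suc)
  have dec': "A $$ (a, b) = ?S $$ (a, b) + (\<Sum>s<Suc t. ?p s * ?l s a * ?l s b)" if ab: "a < n" "b < n" for a b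
  proof -
    have "?d * ?l t a * ?l t b = R $$ (a, i) * inverse ?d * R $$ (i, b)"
    proof (cases "?d = 0")
      case True
      then show ?thesis by simp
    next
      case False
      then have "?l t a = R $$ (a, i) / ?d" "?l t b = R $$ (i, b) / ?d"
        using spsd_sym[OF R i(1) ab(2)] by auto
      then show ?thesis using False by (simp add: field_simps)
    qed
    then show ?thesis using dec[OF ab] ab by simp
  qed
  have R0': "?S $$ (a, ?idx s) = 0" if "s < Suc t" "a < n" for s a
    using that idx_n[of s] i(1) R0[of s] zero[of a i]
    by (cases "s = t"; cases "?d = 0") auto
  have l0': "?l s (?idx q) = 0" if "s < Suc t" "q < s" for s q
    using that l0[of s q] idx_n[of q] R0[of q i] spsd_sym[OF R i(1), of "idx q"] i(1) by (cases "s = t") auto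
  have "sigma (Suc t) A \<le> real n * ?d"
  proof -
    obtain v where E: "eigensystem {..<n} (entry A) v (\<lambda>k. sigma (Suc k) A)"
      using spsd_eigensystem_full[OF A] .
    have tn: "t < card {..<n}"
      using psubset_card_mono[of "{..<n}" I] I i by auto
    \<comment> \<open>Orthogonality to the \<open>t\<close> elimination columns removes the part of
      low rank, so only the residual contributes to the form at \<open>x\<close>.\<close>
    obtain x where x: "\<And>s. s < t \<Longrightarrow> (\<Sum>a<n. l s a * x a) = 0" "0 < (\<Sum>a<n. x a * x a)"
      "sigma (Suc t) A * (\<Sum>a<n. x a * x a) \<le> (\<Sum>a<n. \<Sum>b<n. x a * A $$ (a, b) * x b)"
      using eigensystem_exists_large_form[OF E tn, of l] by blast
    have "(\<Sum>a<n. \<Sum>b<n. x a * A $$ (a, b) * x b) = (\<Sum>a<n. \<Sum>b<n. x a * R $$ (a, b) * x b)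
        + (\<Sum>a<n. \<Sum>b<n. x a * (\<Sum>s<t. p s * l s a * l s b) * x b)"
      unfolding sum.distrib[symmetric] by (intro sum.cong refl) (simp add: dec algebra_simps)
    also have "(\<Sum>a<n. \<Sum>b<n. x a * (\<Sum>s<t. p s * l s a * l s b) * x b) = 0"
      unfolding sum_quadratic_expand using x(1) by simp
    finally have "sigma (Suc t) A * (\<Sum>a<n. x a * x a) \<le> real n * ?d * (\<Sum>a<n. x a * x a)"
      using x(3) spsd_form_le[OF R pivot, of x] by simp
    then show ?thesis using x(2) by simp
  qed
  then have p': "0 \<le> ?p s \<and> sigma (Suc s) A \<le> real n * ?p s" if "s < Suc t" for s
    using p[of s] that spsd_entry_abs_le(1)[OF R i(1) i(1)] by (cases "s = t") auto
  have l1': "?l s (?idx s) = 1" if "s < Suc t" for s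
    using l1[of s] that by (cases "s = t") auto
  have "insert i I \<subseteq> {..<n}" "card (insert i I) = Suc t" using I i fin by auto
  then show ?case
    unfolding dim using spsd_schur_complement[OF R i(1)] bij dec' l1' l0' R0' p'
    by (intro conjI exI[of _ ?idx] exI[of _ ?p] exI[of _ ?l] allI impI)
      (assumption | erule p'[THEN conjunct1] | erule p'[THEN conjunct2])+
qed

text \<open>In the order of selection, the block on the first \<open>r\<close> indices is the
  compression of \<open>A\<close> by coordinate vectors and factors through unit triangular
  matrices. Its determinant, the product of the first \<open>r\<close> pivots, is at most the volume
  of the submatrix, and each pivot is at least \<open>sigma (Suc s) A / n\<close>.\<close>

lemma gecp_volume_ge:
  assumes G: "gecp A K I R" and A: "spsd n A" and r: "r \<le> K"
  shows "proj_volume r A \<le> real n ^ r * proj_volume r (submatrix A I I)"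
proof -
  obtain idx p l where I: "I \<subseteq> {..<n}" "card I = K" and R: "spsd n R"
    and idx: "bij_betw idx {..<K} I"
    and dec: "\<And>a b. a < n \<Longrightarrow> b < n \<Longrightarrow> A $$ (a, b) = R $$ (a, b) + (\<Sum>s<K. p s * l s a * l s b)"
    and l1: "\<And>s. s < K \<Longrightarrow> l s (idx s) = 1" and l0: "\<And>s q. s < K \<Longrightarrow> q < s \<Longrightarrow> l s (idx q) = 0"
    and R0: "\<And>s a. s < K \<Longrightarrow> a < n \<Longrightarrow> R $$ (a, idx s) = 0"
    and p: "\<And>s. s < K \<Longrightarrow> 0 \<le> p s \<and> sigma (Suc s) A \<le> real n * p s"
    using gecp_decomposition[OF G A] by auto
  have fin: "finite I" using I(1) finite_subset by blast
  have idx_n: "idx s \<in> I" "idx s < n" if "s < K" for s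
    using bij_betwE[OF idx] I(1) that by auto
  have inj: "idx s = idx q \<longleftrightarrow> s = q" if "s < K" "q < K" for s q
    using bij_betw_imp_inj_on[OF idx] that by (auto dest: inj_onD)
  obtain u where E: "eigensystem I (entry A) u (\<lambda>k. sigma (Suc k) (submatrix A I I))"
    using spsd_eigensystem[OF A I(1)] .
  define X where "X a i = (if a = idx i then 1 else 0 :: real)" for a i
  have X: "(\<Sum>a\<in>I. X a i * f a) = f (idx i)" if "i < r" for f i
    using fin idx_n[of i] that r by (simp add: X_def if_distrib[of "\<lambda>t. t * _"] cong: if_cong)
  have form: "(\<Sum>a\<in>I. \<Sum>b\<in>I. X a i * A $$ (a, b) * X b j) = (\<Sum>q<r. p q * l q (idx i) * l q (idx j))"
    if ij: "i < r" "j < r" for i j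
  proof -
    have "(\<Sum>a\<in>I. \<Sum>b\<in>I. X a i * A $$ (a, b) * X b j)
        = (\<Sum>a\<in>I. X a i * (\<Sum>b\<in>I. X b j * A $$ (a, b)))"
      by (simp add: sum_distrib_left mult_ac)
    also have "\<dots> = A $$ (idx i, idx j)" using X ij by simp
    also have "\<dots> = (\<Sum>s<K. p s * l s (idx i) * l s (idx j))"
      using ij r R0 by (simp add: dec idx_n)
    also have "\<dots> = (\<Sum>q<r. p q * l q (idx i) * l q (idx j))"
      using ij r l0 by (intro sum.mono_neutral_right) auto
    finally show ?thesis .
  qed
  have "(\<Prod>q<r. p q) = det (mat r r (\<lambda>(i, j). \<Sum>q<r. p q * l q (idx i) * l q (idx j)))"
    using l0 l1 r by (intro det_unit_triangular_congruence[symmetric]) auto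
  also have "mat r r (\<lambda>(i, j). \<Sum>q<r. p q * l q (idx i) * l q (idx j))
      = mat r r (\<lambda>(i, j). \<Sum>a\<in>I. \<Sum>b\<in>I. X a i * A $$ (a, b) * X b j)"
    by (intro eq_matI) (simp_all add: form)
  also have "det \<dots> \<le> proj_volume r (submatrix A I I) * det (mat r r (\<lambda>(i, j). \<Sum>a\<in>I. X a i * X a j))"
    unfolding proj_volume_lessThan by (rule det_compression_le[OF E])
  also have "mat r r (\<lambda>(i, j). \<Sum>a\<in>I. X a i * X a j) = 1\<^sub>m r"
    using inj r by (intro eq_matI) (auto simp: X, auto simp: X_def)
  finally have "(\<Prod>q<r. p q) \<le> proj_volume r (submatrix A I I)" by simp
  moreover have "proj_volume r A \<le> (\<Prod>q<r. real n * p q)"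
    unfolding proj_volume_lessThan using p r sigma_nonneg[OF A] by (intro prod_mono) auto
  ultimately show ?thesis
    by (simp add: prod.distrib) (meson mult_left_mono order_trans zero_le_power of_nat_0_le_iff)
qed

subsection \<open>Error and number of calls\<close>

lemma mult_mat_index_sum:
  assumes "A \<in> carrier_mat n m" "B \<in> carrier_mat m p" "i < n" "j < p"
  shows "(A * B) $$ (i, j) = (\<Sum>k<m. A $$ (i, k) * B $$ (k, j))"
  using assms by (simp add: scalar_prod_def atLeast0LessThan)

text \<open>Sums over \<open>I\<close> replace the matrix products; with \<open>g\<close> the
  truncated inverse spectrum this becomes, by symmetry of \<open>W\<close>, the expression bounded
  in \<open>truncation_error_abs_le\<close>.\<close>

lemma cur_error_index:
  fixes W P :: "real mat"
  assumes W: "W \<in> carrier_mat n n" and I: "I \<subseteq> {..<n}" and P: "P \<in> carrier_mat (card I) (card I)"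
    and ab: "a < n" "b < n"
  shows "(W - submatrix W UNIV I * (P * mat_diag (card I) g * P\<^sup>T) * submatrix W I UNIV) $$ (a, b)
    = W $$ (a, b) - (\<Sum>k<card I. g k * (\<Sum>c\<in>I. P $$ (card {x \<in> I. x < c}, k) * W $$ (a, c))
        * (\<Sum>c\<in>I. P $$ (card {x \<in> I. x < c}, k) * W $$ (c, b)))"
proof -
  have fin: "finite I" using I finite_subset by blast
  let ?K = "card I"
  define U where "U = P * mat_diag ?K g * P\<^sup>T"
  let ?C = "submatrix W UNIV I" and ?R = "submatrix W I UNIV"
  note C = submatrix_cols[OF W I] and R = submatrix_rows[OF W I]
  have Uc: "U \<in> carrier_mat ?K ?K" using P by (simp add: U_def mult_carrier_mat[of _ ?K ?K _ ?K])
  have CU: "(?C * U) $$ (a, j) = (\<Sum>i<?K. W $$ (a, pick I i) * U $$ (i, j))" if "j < ?K" for j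
  proof -
    have "(?C * U) $$ (a, j) = (\<Sum>i<?K. ?C $$ (a, i) * U $$ (i, j))"
      by (rule mult_mat_index_sum[OF C(1) Uc ab(1) that])
    then show ?thesis using C(2) ab by simp
  qed
  have CUc: "?C * U \<in> carrier_mat n ?K" using C(1) Uc by (rule mult_carrier_mat)
  have "(?C * U * ?R) $$ (a, b) = (\<Sum>j<?K. (?C * U) $$ (a, j) * ?R $$ (j, b))"
    by (rule mult_mat_index_sum[OF CUc R(1) ab])
  also have "\<dots> = (\<Sum>j<?K. \<Sum>i<?K. W $$ (a, pick I i) * U $$ (i, j) * W $$ (pick I j, b))"
    using R(2) ab by (intro sum.cong refl) (simp add: CU sum_distrib_right)
  also have "\<dots> = (\<Sum>i<?K. \<Sum>j<?K. W $$ (a, pick I i)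
      * (\<Sum>k<?K. g k * P $$ (i, k) * P $$ (j, k)) * W $$ (pick I j, b))"
    by (subst sum.swap) (simp add: U_def diag_conjugation_index[OF P])
  also have "\<dots> = (\<Sum>k<?K. g k * (\<Sum>i<?K. P $$ (i, k) * W $$ (a, pick I i))
      * (\<Sum>j<?K. P $$ (j, k) * W $$ (pick I j, b)))"
    by (rule sum_quadratic_expand[of _ g "\<lambda>k i. P $$ (i, k)" "\<lambda>k i. P $$ (i, k)"])
  also have "\<dots> = (\<Sum>k<?K. g k * (\<Sum>c\<in>I. P $$ (card {x \<in> I. x < c}, k) * W $$ (a, c))
      * (\<Sum>c\<in>I. P $$ (card {x \<in> I. x < c}, k) * W $$ (c, b)))"
    unfolding sum_pick[OF fin, symmetric]
    by (intro sum.cong refl arg_cong2[where f = "(*)"]) (simp_all add: card_pick_le)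
  finally have CUR: "(?C * U * ?R) $$ (a, b) = \<dots>" .
  have "?C * U * ?R \<in> carrier_mat n n" using CUc R(1) by (rule mult_carrier_mat)
  then have "a < dim_row (?C * U * ?R)" "b < dim_col (?C * U * ?R)" using ab by blast+
  then show ?thesis unfolding CUR[symmetric] U_def[symmetric] by (rule index_minus_mat(1))
qed

lemma chebyshev_norm_le:
  assumes "M \<in> carrier_mat n n" "0 < n" "\<And>a b. a < n \<Longrightarrow> b < n \<Longrightarrow> \<bar>M $$ (a, b)\<bar> \<le> c"
  shows "chebyshev_norm M \<le> c"
proof -
  have "M $$ (0, 0) \<in> elements_mat M" using assms(1,2) by auto
  then have "elements_mat M \<noteq> {}" by blast
  moreover have "finite (elements_mat M)" unfolding elements_mat_def by simp
  moreover have "x \<le> c" if "x \<in> abs ` elements_mat M" for x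
    using that assms(1,3) by (auto dest!: elements_matD)
  ultimately show ?thesis unfolding chebyshev_norm_def by (intro Max.boundedI) auto
qed

text \<open>Only diagonal entries outside \<open>I\<close> are left to be bounded. That hypothesis
  ranges over all eigenvectors \<open>u\<close>, because the ones that occur are dictated by the
  singular value decomposition behind \<open>T\<close>.\<close>

lemma cur_error_le:
  assumes W: "spsd n W" and I: "I \<subseteq> {..<n}" and r: "r < card I"
    and T: "rank_truncation r (submatrix W I I) T"
    and inside: "sigma (Suc r) W \<le> M"
    and outside: "\<And>u j. eigensystem I (entry W) u (\<lambda>k. sigma (Suc k) (submatrix W I I)) \<Longrightarrow>
      j < n \<Longrightarrow> j \<notin> I \<Longrightarrow>
      W $$ (j, j) - (\<Sum>k<r. inverse (sigma (Suc k) (submatrix W I I)) * (\<Sum>c\<in>I. u k c * W $$ (c, j))\<^sup>2) \<le> M"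
  shows "chebyshev_norm (W - submatrix W UNIV I * pinv T * submatrix W I UNIV) \<le> M"
proof -
  let ?A = "submatrix W I I"
  let ?s = "\<lambda>k. sigma (Suc k) ?A"
  have Wc: "W \<in> carrier_mat n n" using W by (simp add: spsd_def)
  have A: "spsd (card I) ?A" by (rule spsd_submatrix[OF W I])
  obtain P where P: "orthogonal_matrix (card I) P" and AP: "?A = P * mat_diag (card I) ?s * P\<^sup>T"
    and TP: "T = P * mat_diag (card I) (\<lambda>k. if k < r then ?s k else 0) * P\<^sup>T"
    using rank_truncation_spsd[OF A T] .
  have Pc: "P \<in> carrier_mat (card I) (card I)" using P by (simp add: orthogonal_matrix_def)
  define u where "u k a = P $$ (card {x \<in> I. x < a}, k)" for k a
  have E: "eigensystem I (entry W) u ?s"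
    unfolding u_def using sigma_nonneg[OF A] sigma_antimono[OF A]
    by (intro eigensystem_submatrix[OF Wc I P AP]) auto
  obtain v where F: "eigensystem {..<n} (entry W) v (\<lambda>k. sigma (Suc k) W)"
    using spsd_eigensystem_full[OF W] .
  have diag: "W $$ (a, a) - (\<Sum>k<r. inverse (?s k) * (\<Sum>c\<in>I. u k c * W $$ (c, a))\<^sup>2) \<le> M" if "a < n" for a
  proof (cases "a \<in> I")
    case True
    then show ?thesis
      using truncation_error_inside_le[OF E r True] eigensystem_interlacing[OF E F I r] inside by simp
  next
    case False
    then show ?thesis by (rule outside[OF E that])
  qed
  have U: "pinv T = P * mat_diag (card I) (\<lambda>k. inverse (if k < r then ?s k else 0)) * P\<^sup>T"
    by (rule pinv_diagonalized[OF P TP])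
  have "pinv T \<in> carrier_mat (card I) (card I)"
    unfolding U using Pc by (simp add: mult_carrier_mat[of _ "card I" "card I" _ "card I"])
  from mult_carrier_mat[OF mult_carrier_mat[OF submatrix_cols(1)[OF Wc I] this] submatrix_rows(1)[OF Wc I]]
  have "W - submatrix W UNIV I * pinv T * submatrix W I UNIV \<in> carrier_mat n n"
    by (rule minus_carrier_mat)
  moreover have "0 < n" using I r by (cases n) auto
  ultimately show ?thesis
  proof (rule chebyshev_norm_le)
    fix a b assume ab: "a < n" "b < n"
    have sym: "(\<Sum>c\<in>I. u k c * W $$ (a, c)) = (\<Sum>c\<in>I. u k c * W $$ (c, a))" for k
      using I ab by (intro sum.cong refl) (auto simp: spsd_sym[OF W ab(1)])
    have "(W - submatrix W UNIV I * pinv T * submatrix W I UNIV) $$ (a, b)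
        = W $$ (a, b) - (\<Sum>k<card I. inverse (if k < r then ?s k else 0)
          * (\<Sum>c\<in>I. u k c * W $$ (c, a)) * (\<Sum>c\<in>I. u k c * W $$ (c, b)))"
      unfolding U cur_error_index[OF Wc I Pc ab] u_def[symmetric] sym ..
    also have "(\<Sum>k<card I. inverse (if k < r then ?s k else 0)
          * (\<Sum>c\<in>I. u k c * W $$ (c, a)) * (\<Sum>c\<in>I. u k c * W $$ (c, b)))
        = (\<Sum>k<r. inverse (?s k) * (\<Sum>c\<in>I. u k c * W $$ (c, a)) * (\<Sum>c\<in>I. u k c * W $$ (c, b)))"
      using r by (intro sum.mono_neutral_cong_right) auto
    finally show "\<bar>(W - submatrix W UNIV I * pinv T * submatrix W I UNIV) $$ (a, b)\<bar> \<le> M"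
      using truncation_error_abs_le[OF F E I, of r M a b] r diag ab by simp
  qed
qed

lemma proj_volume_submatrix_le:
  assumes W: "spsd n W" and I: "I \<subseteq> {..<n}" and r: "r \<le> card I"
  shows "proj_volume r (submatrix W I I) \<le> proj_volume r W"
proof -
  obtain u where E: "eigensystem I (entry W) u (\<lambda>k. sigma (Suc k) (submatrix W I I))"
    using spsd_eigensystem[OF W I] .
  obtain v where F: "eigensystem {..<n} (entry W) v (\<lambda>k. sigma (Suc k) W)"
    using spsd_eigensystem_full[OF W] .
  show ?thesis
    unfolding proj_volume_lessThan
    using eigensystem_interlacing[OF E F I] sigma_nonneg[OF spsd_submatrix[OF W I]] r
    by (intro prod_mono) auto
qed

text \<open>Positivity of the volume serves twice: it turns the failed quotient tests into bounds on
  the volumes after a swap, and it allows the volume to be cancelled at the end. Passing to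
  \<open>sigma (Suc r) W\<close> is interlacing.\<close>

lemma outside_error_le:
  assumes W: "spsd n W" and I: "I \<subseteq> {..<n}" and r: "r < card I" and eps: "0 < \<epsilon>"
    and opt: "\<nexists>J. improving_swap W I r \<epsilon> J" and pos: "0 < proj_volume r (submatrix W I I)"
    and E: "eigensystem I (entry W) u (\<lambda>k. sigma (Suc k) (submatrix W I I))" and j: "j < n" "j \<notin> I"
  shows "W $$ (j, j) - (\<Sum>k<r. inverse (sigma (Suc k) (submatrix W I I)) * (\<Sum>c\<in>I. u k c * W $$ (c, j))\<^sup>2)
    \<le> (1 + \<epsilon>) * ((real (card I) + 1) / (real (card I) - real r + 1)) * sigma (Suc r) W"
    (is "?e \<le> _")
proof -
  let ?J = "insert j I" and ?K = "real (card I)"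
  let ?V = "proj_volume r (submatrix W I I)" and ?VJ = "proj_volume r (submatrix W ?J ?J)"
  have fin: "finite I" using I finite_subset by blast
  have J: "?J \<subseteq> {..<n}" "card ?J = Suc (card I)" using I j fin by auto
  have dim: "dim_row W = n" using W by (auto simp: spsd_def)
  obtain v where F: "eigensystem ?J (entry W) v (\<lambda>k. sigma (Suc k) (submatrix W ?J ?J))"
    using spsd_eigensystem[OF W J(1)] .
  obtain w where G: "eigensystem {..<n} (entry W) w (\<lambda>k. sigma (Suc k) W)"
    using spsd_eigensystem_full[OF W] .
  have "(real (card ?J) - real r) * (\<Prod>k<r. sigma (Suc k) (submatrix W ?J ?J)) \<le> real (card ?J) * ((1 + \<epsilon>) * ?V)"
  proof (rule volume_average[OF F])
    fix i assume i: "i \<in> ?J"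
    have sub: "?J - {i} \<subseteq> {..<n}" using J(1) by auto
    obtain x where "eigensystem (?J - {i}) (entry W) x (\<lambda>k. sigma (Suc k) (submatrix W (?J - {i}) (?J - {i})))"
      using spsd_eigensystem[OF W sub] .
    moreover have "proj_volume r (submatrix W (?J - {i}) (?J - {i})) \<le> (1 + \<epsilon>) * ?V"
    proof (cases "i = j")
      case True
      then have "?J - {i} = I" using j by auto
      then show ?thesis using pos eps by simp
    next
      case False
      then have "?J - {i} = insert j (I - {i})" "i \<in> I" using i by auto
      then have "\<not> proj_volume r (submatrix W (?J - {i}) (?J - {i})) / ?V > 1 + \<epsilon>"
        using opt j unfolding improving_swap_def dim by blast
      then show ?thesis using pos by (simp add: divide_le_eq not_less)
    qed
    ultimately show "\<exists>u l. eigensystem (?J - {i}) (entry W) u l \<and> (\<Prod>k<r. l k) \<le> (1 + \<epsilon>) * ?V"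
      unfolding proj_volume_lessThan by blast
  qed (use r J in simp)
  then have avg: "(?K - real r + 1) * ?VJ \<le> (?K + 1) * ((1 + \<epsilon>) * ?V)"
    unfolding proj_volume_lessThan[symmetric] J(2) by (simp add: algebra_simps)
  have "?e * ?V \<le> (\<Prod>k<Suc r. sigma (Suc k) (submatrix W ?J ?J))"
    unfolding proj_volume_lessThan
    using truncation_error_mult_volume_le[OF E j(2) F] r by simp
  also have "\<dots> = ?VJ * sigma (Suc r) (submatrix W ?J ?J)"
    by (simp add: proj_volume_lessThan)
  also have "\<dots> \<le> ?VJ * sigma (Suc r) W"
    using eigensystem_interlacing[OF F G J(1), of r] r J(2)
      proj_volume_nonneg[OF spsd_submatrix[OF W J(1)]] by (intro mult_left_mono) auto
  also have "\<dots> \<le> (?K + 1) * ((1 + \<epsilon>) * ?V) / (?K - real r + 1) * sigma (Suc r) W"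
    using avg r sigma_nonneg[OF W] by (intro mult_right_mono) (auto simp: pos_le_divide_eq mult.commute)
  also have "\<dots> = (1 + \<epsilon>) * ((?K + 1) / (?K - real r + 1)) * sigma (Suc r) W * ?V"
    by simp
  finally show ?thesis by (rule mult_right_le_imp_le[OF _ pos])
qed

text \<open>Here \<open>q\<close> is the rank of \<open>W\<close>, which is less than
  \<open>r\<close>. GECP keeps the volume of order \<open>q\<close> positive, while the volume of
  order \<open>q + 1\<close> vanishes for every principal submatrix, so the error after
  \<open>q\<close> terms is at most 0. The terms from \<open>q\<close> on have singular value 0 and
  thus coefficient 0.\<close>

lemma outside_error_le_degenerate:
  assumes W: "spsd n W" and I: "I \<subseteq> {..<n}" and r: "r < card I"
    and gecp: "gecp W (card I) I R" and zero: "proj_volume r (submatrix W I I) = 0"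
    and E: "eigensystem I (entry W) u (\<lambda>k. sigma (Suc k) (submatrix W I I))" and j: "j < n" "j \<notin> I"
  shows "W $$ (j, j) - (\<Sum>k<r. inverse (sigma (Suc k) (submatrix W I I)) * (\<Sum>c\<in>I. u k c * W $$ (c, j))\<^sup>2) \<le> 0"
proof -
  let ?A = "submatrix W I I" and ?J = "insert j I"
  have fin: "finite I" using I finite_subset by blast
  have J: "?J \<subseteq> {..<n}" "card ?J = Suc (card I)" using I j fin by auto
  have A: "spsd (card I) ?A" by (rule spsd_submatrix[OF W I])
  obtain v where F: "eigensystem ?J (entry W) v (\<lambda>k. sigma (Suc k) (submatrix W ?J ?J))"
    using spsd_eigensystem[OF W J(1)] .
  obtain w where G: "eigensystem {..<n} (entry W) w (\<lambda>k. sigma (Suc k) W)"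
    using spsd_eigensystem_full[OF W] .
  have "proj_volume r W = 0"
    using gecp_volume_ge[OF gecp W, of r] r zero proj_volume_nonneg[OF W, of r] by simp
  then have ex: "\<exists>k<r. sigma (Suc k) W = 0" unfolding proj_volume_lessThan by auto
  define q where "q = (LEAST k. sigma (Suc k) W = 0)"
  have q: "sigma (Suc q) W = 0" "q < r"
    using ex LeastI_ex[of "\<lambda>k. sigma (Suc k) W = 0"] Least_le[of "\<lambda>k. sigma (Suc k) W = 0"]
    unfolding q_def by (blast, meson le_less_trans)
  have "0 < sigma (Suc k) W" if "k < q" for k
    using not_less_Least[OF that[unfolded q_def]] sigma_nonneg[OF W, of "Suc k"] by simp
  then have "0 < proj_volume q W" unfolding proj_volume_lessThan by (intro prod_pos) auto
  also have "\<dots> \<le> real n ^ q * proj_volume q ?A" using q r by (intro gecp_volume_ge[OF gecp W]) simp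
  finally have pos: "0 < proj_volume q ?A"
    using proj_volume_nonneg[OF A, of q] by (cases "proj_volume q ?A = 0") auto
  have "sigma (Suc q) (submatrix W ?J ?J) = 0"
    using eigensystem_interlacing[OF F G J(1), of q] q r J(2) sigma_nonneg[OF spsd_submatrix[OF W J(1)], of "Suc q"]
    by simp
  then have zeroJ: "(\<Prod>k<Suc q. sigma (Suc k) (submatrix W ?J ?J)) = 0" by simp
  have "q \<le> card I" using q r by simp
  from truncation_error_mult_volume_le[OF E j(2) F this]
  have "(W $$ (j, j) - (\<Sum>k<q. inverse (sigma (Suc k) ?A) * (\<Sum>c\<in>I. u k c * W $$ (c, j))\<^sup>2))
      * proj_volume q ?A \<le> 0"
    unfolding zeroJ proj_volume_lessThan .
  then have "W $$ (j, j) - (\<Sum>k<q. inverse (sigma (Suc k) ?A) * (\<Sum>c\<in>I. u k c * W $$ (c, j))\<^sup>2) \<le> 0"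
    using pos by (simp add: mult_le_0_iff)
  moreover have "sigma (Suc k) ?A = 0" if "q \<le> k" "k < r" for k
    using eigensystem_interlacing[OF E G I, of k] sigma_antimono[OF W, of "Suc q" "Suc k"] q(1) that r
      sigma_nonneg[OF A, of "Suc k"] by simp
  then have "(\<Sum>k<q. inverse (sigma (Suc k) ?A) * (\<Sum>c\<in>I. u k c * W $$ (c, j))\<^sup>2)
      = (\<Sum>k<r. inverse (sigma (Suc k) ?A) * (\<Sum>c\<in>I. u k c * W $$ (c, j))\<^sup>2)"
    using q(2) by (intro sum.mono_neutral_left) auto
  ultimately show ?thesis by simp
qed

section \<open>Executions of the Main Algorithm\<close>

text \<open>Division by a zero volume yields 0, so a quotient above \<open>1 + \<epsilon>\<close>
  certifies that the old volume is positive.\<close>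

lemma improving_swapD:
  assumes W: "spsd n W" and I: "I \<subseteq> {..<n}" and imp: "improving_swap W I r \<epsilon> J" and eps: "0 < \<epsilon>"
  shows "J \<subseteq> {..<n}" "card J = card I" "J \<noteq> I" "0 < proj_volume r (submatrix W I I)"
    "(1 + \<epsilon>) * proj_volume r (submatrix W I I) \<le> proj_volume r (submatrix W J J)"
proof -
  have fin: "finite I" using I finite_subset by blast
  have dim: "dim_row W = n" using W by (auto simp: spsd_def)
  obtain i j where ij: "i \<in> I" "j < n" "j \<notin> I" "J = insert j (I - {i})"
    and q: "proj_volume r (submatrix W J J) / proj_volume r (submatrix W I I) > 1 + \<epsilon>"
    using imp unfolding improving_swap_def dim by auto
  show "J \<subseteq> {..<n}" using ij I by auto
  have "card J = Suc (card (I - {i}))" using ij fin by simp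
  then show "card J = card I" using card_Suc_Diff1[OF fin ij(1)] by simp
  show "J \<noteq> I" using ij by auto
  show V: "0 < proj_volume r (submatrix W I I)"
    using q eps proj_volume_nonneg[OF spsd_submatrix[OF W I], of r]
    by (cases "proj_volume r (submatrix W I I) = 0") auto
  show "(1 + \<epsilon>) * proj_volume r (submatrix W I I) \<le> proj_volume r (submatrix W J J)"
    using q V by (simp add: pos_less_divide_eq)
qed

text \<open>\<open>m'\<close> counts the successful updates: the last call of a finished execution changes nothing.\<close>

lemma main_run_invariant:
  assumes "main_run W K r \<epsilon> m I stopped" and W: "spsd n W" and eps: "0 < \<epsilon>"
  shows "\<exists>I\<^sub>0 R m'. gecp W K I\<^sub>0 R \<and> I \<subseteq> {..<n} \<and> card I = K \<and>
    (1 + \<epsilon>) ^ m' * proj_volume r (submatrix W I\<^sub>0 I\<^sub>0) \<le> proj_volume r (submatrix W I I) \<and>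
    (if m' = 0 then I = I\<^sub>0 else 0 < proj_volume r (submatrix W I\<^sub>0 I\<^sub>0)) \<and>
    (if stopped then m = Suc m' \<and> (\<nexists>J. improving_swap W I r \<epsilon> J) else m = m')"
  using assms(1)
proof induction
  case (init I R)
  then show ?case
    using gecp_decomposition[OF init W] by (intro exI[of _ I] exI[of _ R] exI[of _ 0]) auto
next
  case (update m I J)
  \<comment> \<open>Only an unfinished execution is continued, so all \<open>m\<close> calls made so
    far were successful updates.\<close>
  obtain I\<^sub>0 R where G: "gecp W K I\<^sub>0 R" and I: "I \<subseteq> {..<n}" "card I = K"
    and le: "(1 + \<epsilon>) ^ m * proj_volume r (submatrix W I\<^sub>0 I\<^sub>0) \<le> proj_volume r (submatrix W I I)"
    and m: "if m = 0 then I = I\<^sub>0 else 0 < proj_volume r (submatrix W I\<^sub>0 I\<^sub>0)"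
    using update.IH by auto
  show ?case
  proof (cases "improving_swap W I r \<epsilon> J")
    case True
    note D = improving_swapD[OF W I(1) True eps]
    have "(1 + \<epsilon>) ^ Suc m * proj_volume r (submatrix W I\<^sub>0 I\<^sub>0) \<le> (1 + \<epsilon>) * proj_volume r (submatrix W I I)"
      using mult_left_mono[OF le, of "1 + \<epsilon>"] eps by (simp add: mult.assoc)
    then have "(1 + \<epsilon>) ^ Suc m * proj_volume r (submatrix W I\<^sub>0 I\<^sub>0) \<le> proj_volume r (submatrix W J J)"
      using D(5) by simp
    moreover have "0 < proj_volume r (submatrix W I\<^sub>0 I\<^sub>0)" using m D(4) by (cases "m = 0") auto
    ultimately show ?thesis using G D I(2)
      by (intro exI[of _ I\<^sub>0] exI[of _ R] exI[of _ "Suc m"]) simp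
  next
    case False
    then have "J = I" "\<nexists>J. improving_swap W I r \<epsilon> J"
      using update.hyps(2) unfolding index_update_def by auto
    then show ?thesis using G I le m by (intro exI[of _ I\<^sub>0] exI[of _ R] exI[of _ m]) simp
  qed
qed

lemma main_output_error_le:
  assumes W: "spsd n W" and r: "r < K" and eps: "0 < \<epsilon>" and out: "main_output W K r \<epsilon> I"
    and T: "rank_truncation r (submatrix W I I) T"
  shows "chebyshev_norm (W - submatrix W UNIV I * pinv T * submatrix W I UNIV)
    \<le> (1 + \<epsilon>) * ((real K + 1) / (real K - real r + 1)) * sigma (r + 1) W"
proof -
  obtain m I\<^sub>0 R m' where G: "gecp W K I\<^sub>0 R" and I: "I \<subseteq> {..<n}" "card I = K"
    and le: "(1 + \<epsilon>) ^ m' * proj_volume r (submatrix W I\<^sub>0 I\<^sub>0) \<le> proj_volume r (submatrix W I I)"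
    and m': "if m' = 0 then I = I\<^sub>0 else 0 < proj_volume r (submatrix W I\<^sub>0 I\<^sub>0)"
    and opt: "\<nexists>J. improving_swap W I r \<epsilon> J"
    using out main_run_invariant[OF _ W eps] unfolding main_output_def by (metis (full_types))
  have rI: "r < card I" using r I by simp
  let ?M = "(1 + \<epsilon>) * ((real K + 1) / (real K - real r + 1)) * sigma (Suc r) W"
  have s: "0 \<le> sigma (Suc r) W" by (rule sigma_nonneg[OF W])
  \<comment> \<open>The factor is at least 1, so the weaker requirement inside \<open>I\<close> is
    covered by the same bound.\<close>
  have "1 * 1 \<le> (1 + \<epsilon>) * ((real K + 1) / (real K - real r + 1))"
    using eps r by (intro mult_mono) (auto simp: pos_le_divide_eq)
  then have inside: "sigma (Suc r) W \<le> ?M"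
    using mult_right_mono[OF _ s, of 1] by (simp only: mult_1_left)
  have "chebyshev_norm (W - submatrix W UNIV I * pinv T * submatrix W I UNIV) \<le> ?M"
  proof (rule cur_error_le[OF W I(1) rI T inside])
    fix u j
    assume E: "eigensystem I (entry W) u (\<lambda>k. sigma (Suc k) (submatrix W I I))" and j: "j < n" "j \<notin> I"
    show "W $$ (j, j) - (\<Sum>k<r. inverse (sigma (Suc k) (submatrix W I I)) * (\<Sum>c\<in>I. u k c * W $$ (c, j))\<^sup>2) \<le> ?M"
    proof (cases "proj_volume r (submatrix W I I) = 0")
      case True
      \<comment> \<open>A successful update starts from a positive volume and increases it; volume 0
        means that none took place, and \<open>I\<close> is still the output of GECP.\<close>
      have "m' = 0"
      proof (rule ccontr)
        assume "m' \<noteq> 0"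
        then have "0 < (1 + \<epsilon>) ^ m' * proj_volume r (submatrix W I\<^sub>0 I\<^sub>0)"
          using m' eps by (intro mult_pos_pos) auto
        then show False using le True by simp
      qed
      then have "gecp W (card I) I R" using m' G I by simp
      from outside_error_le_degenerate[OF W I(1) rI this True E j] show ?thesis using inside s by linarith
    next
      case False
      then have "0 < proj_volume r (submatrix W I I)"
        using proj_volume_nonneg[OF spsd_submatrix[OF W I(1)], of r] by simp
      from outside_error_le[OF W I(1) rI eps opt this E j] show ?thesis unfolding I(2) .
    qed
  qed
  then show ?thesis by simp
qed

text \<open>The summand 1 pays for the last call, which changes nothing. If an update succeeded, the
  initial volume is positive and cancels between the growth by powers of
  \<open>1 + \<epsilon>\<close> and the guarantee of GECP.\<close>

lemma main_run_calls_le: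
  assumes run: "main_run W K r \<epsilon> m I stopped" and W: "spsd n W" and eps: "0 < \<epsilon>" "\<epsilon> \<le> 1 / 2"
    and r: "r \<le> K" and n: "0 < n"
  shows "real m \<le> 1 + 2 * (real r * ln (real n)) / \<epsilon>"
proof -
  obtain I\<^sub>0 R m' where G: "gecp W K I\<^sub>0 R" and I: "I \<subseteq> {..<n}" "card I = K"
    and le: "(1 + \<epsilon>) ^ m' * proj_volume r (submatrix W I\<^sub>0 I\<^sub>0) \<le> proj_volume r (submatrix W I I)"
    and m': "if m' = 0 then I = I\<^sub>0 else 0 < proj_volume r (submatrix W I\<^sub>0 I\<^sub>0)"
    and m: "if stopped then m = Suc m' \<and> (\<nexists>J. improving_swap W I r \<epsilon> J) else m = m'"
    using main_run_invariant[OF run W eps(1)] by (elim exE conjE)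
  have "real m' * (\<epsilon> / 2) \<le> real r * ln (real n)"
  proof (cases "m' = 0")
    case True
    then show ?thesis using n by simp
  next
    case False
    then have V: "0 < proj_volume r (submatrix W I\<^sub>0 I\<^sub>0)" using m' by simp
    have "(1 + \<epsilon>) ^ m' * proj_volume r (submatrix W I\<^sub>0 I\<^sub>0) \<le> proj_volume r W"
      using le proj_volume_submatrix_le[OF W I(1), of r] r I(2) by simp
    also have "\<dots> \<le> real n ^ r * proj_volume r (submatrix W I\<^sub>0 I\<^sub>0)"
      by (rule gecp_volume_ge[OF G W r])
    finally have "(1 + \<epsilon>) ^ m' \<le> real n ^ r" using V by simp
    then have "ln ((1 + \<epsilon>) ^ m') \<le> ln (real n ^ r)" using eps n by simp
    then have "real m' * ln (1 + \<epsilon>) \<le> real r * ln (real n)" using eps n by (simp add: ln_realpow)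
    \<comment> \<open>From ln (1 + \<epsilon>) \<ge> \<epsilon> - \<epsilon>^2 and \<epsilon> \<le>
      1/2; this is the origin of the constant 2.\<close>
    moreover have "\<epsilon> / 2 \<le> ln (1 + \<epsilon>)"
    proof -
      have "\<epsilon> * \<epsilon> \<le> \<epsilon> * (1 / 2)" using eps by (intro mult_left_mono) auto
      then show ?thesis using ln_one_plus_pos_lower_bound[of \<epsilon>] eps
        unfolding power2_eq_square by linarith
    qed
    then have "real m' * (\<epsilon> / 2) \<le> real m' * ln (1 + \<epsilon>)" by (intro mult_left_mono) auto
    ultimately show ?thesis by simp
  qed
  then have "real m' \<le> 2 * (real r * ln (real n)) / \<epsilon>" using eps by (simp add: field_simps)
  moreover have "m \<le> Suc m'" using m by (cases stopped) auto
  ultimately show ?thesis by simp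
qed

lemma main_cost_bound_main_run:
  assumes "gecp_counted gc" "update_counted uc"
  shows "main_cost_bound gc uc
    (\<lambda>n K r \<epsilon>. (real r + ln (real n)) * real r * real K ^ 4 * real n * inverse \<epsilon>)"
proof -
  obtain c1 where c1: "\<And>n K. 0 < K \<Longrightarrow> K < n \<Longrightarrow> real (gc n K) \<le> c1 * (real n * real K ^ 2)"
    using assms(1) unfolding gecp_counted_def by auto
  obtain c2 where c2: "\<And>n K r. 0 < r \<Longrightarrow> r \<le> K \<Longrightarrow> K < n \<Longrightarrow> real (uc n K r) \<le> c2 * (real K ^ 4 * real n)"
    using assms(2) unfolding update_counted_def by auto
  \<comment> \<open>With \<open>X\<close> and \<open>Y\<close> as below, the calls number at most 1
    + 2 X \<le> 3 X, each costing a multiple of \<open>Y\<close>, and GECP is absorbed by X Y since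
    X \<ge> 1. The absolute values guard against negative constants \<open>c1\<close>,
    \<open>c2\<close>.\<close>
  let ?C = "\<bar>c1\<bar> + 3 * \<bar>c2\<bar>"
  have "real (main_cost gc uc n K r m) \<le> ?C * ((real r + ln (real n)) * real r * real K ^ 4 * real n * inverse \<epsilon>)"
    if eps: "0 < \<epsilon>" "\<epsilon> < 1 / 2" and rK: "0 < r" "r < K" "K < n" and W: "spsd n A"
      and run: "main_run A K r \<epsilon> m I stopped"
    for \<epsilon> n r K A m I stopped
  proof -
    define X where "X = (real r + ln (real n)) * real r * inverse \<epsilon>"
    define Y where "Y = real K ^ 4 * real n"
    have ln0: "0 \<le> ln (real n)" using rK by simp
    have Y: "0 \<le> Y" by (simp add: Y_def)
    have "1 \<le> inverse \<epsilon>" using eps by (simp add: one_le_inverse)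
    moreover have "1 \<le> real r + ln (real n)" using rK ln0 by linarith
    ultimately have "1 * 1 * 1 \<le> X"
      unfolding X_def using rK by (intro mult_mono) auto
    then have X1: "1 \<le> X" by simp
    have "real r * ln (real n) \<le> (real r + ln (real n)) * real r"
      by (simp add: algebra_simps)
    then have "real r * ln (real n) * inverse \<epsilon> \<le> X"
      unfolding X_def by (rule mult_right_mono) (use eps in simp)
    then have "2 * (real r * ln (real n)) / \<epsilon> \<le> 2 * X"
      by (simp only: divide_inverse mult.assoc)
    then have m: "real m \<le> 3 * X"
      using main_run_calls_le[OF run W] eps rK X1 by simp
    have "real K ^ 2 \<le> real K ^ 4" using rK by (intro power_increasing) auto
    then have "real n * real K ^ 2 \<le> Y" unfolding Y_def by (simp add: mult.commute mult_left_mono)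
    then have "c1 * (real n * real K ^ 2) \<le> \<bar>c1\<bar> * Y"
      by (intro mult_mono) auto
    also have "\<dots> \<le> \<bar>c1\<bar> * (X * Y)" using X1 Y by (intro mult_left_mono) (auto simp: mult_le_cancel_right1)
    finally have g: "real (gc n K) \<le> \<bar>c1\<bar> * (X * Y)" using c1[of K n] rK by simp
    have "real (uc n K r) \<le> c2 * Y" using c2[of r K n] rK unfolding Y_def by simp
    also have "\<dots> \<le> \<bar>c2\<bar> * Y" using Y by (intro mult_right_mono) auto
    finally have "real m * real (uc n K r) \<le> (3 * X) * (\<bar>c2\<bar> * Y)"
      using m X1 Y by (intro mult_mono) auto
    then have "real (main_cost gc uc n K r m) \<le> ?C * (X * Y)"
      using g by (simp add: main_cost_def algebra_simps)
    then show ?thesis by (simp add: X_def Y_def mult_ac)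
  qed
  \<comment> \<open>The threshold 1/2 depends on none of \<open>n\<close>, \<open>K\<close>,
    \<open>r\<close>, \<open>A\<close>, as the uniform bound demands.\<close>
  moreover have "\<forall>\<^sub>F \<epsilon> in at_right 0. 0 < \<epsilon> \<and> \<epsilon> < (1 / 2 :: real)"
    by (rule eventually_at_rightI[of _ "1 / 2"]) auto
  ultimately show ?thesis
    unfolding main_cost_bound_def by (intro exI[of _ ?C]) (auto elim!: eventually_mono)
qed

theorem theorem6p2:
  shows "(\<forall>(n::nat) (r::nat) (K::nat) (\<epsilon>::real) W I T C U R.
            spsd n W \<and> 0 < r \<and> r < K \<and> K < n \<and> 0 < \<epsilon> \<and> main_output W K r \<epsilon> I \<and>
            C = submatrix W UNIV I \<and>
            rank_truncation r (submatrix W I I) T \<and> U = pinv T \<and>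
            R = submatrix W I UNIV \<longrightarrow>
            chebyshev_norm (W - C * U * R)
              \<le> (1 + \<epsilon>) * ((real K + 1) / (real K - real r + 1)) * sigma (r + 1) W \<and>
            (\<forall>c::real. 1 < c \<and> real K = c * real r - 1 \<longrightarrow>
               chebyshev_norm (W - C * U * R)
                 \<le> (1 + 1 / (c - 1)) * (1 + \<epsilon>) * sigma (r + 1) W)) \<and>
         (\<forall>gc uc. gecp_counted gc \<and> update_counted uc \<longrightarrow>
            main_cost_bound gc uc
              (\<lambda>n K r \<epsilon>. (real r + ln (real n)) * real r * real K ^ 4 * real n * inverse \<epsilon>))"
proof (intro conjI[of "\<forall>n. _ n"] allI impI, goal_cases)
  case (1 n r K \<epsilon> W I T C U R)
  then have bound: "chebyshev_norm (W - C * U * R)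
      \<le> (1 + \<epsilon>) * ((real K + 1) / (real K - real r + 1)) * sigma (r + 1) W"
    using main_output_error_le by blast
  have "0 < r" using 1 by blast
  have "chebyshev_norm (W - C * U * R) \<le> (1 + 1 / (c - 1)) * (1 + \<epsilon>) * sigma (r + 1) W"
    if c: "1 < c" "real K = c * real r - 1" for c :: real
  proof -
    \<comment> \<open>The choice K + 1 = c r lets \<open>r\<close> cancel from the quotient.\<close>
    have "(real K + 1) / (real K - real r + 1) = (c * real r) / ((c - 1) * real r)"
      unfolding c(2) by (simp add: algebra_simps)
    also have "\<dots> = 1 + 1 / (c - 1)" using c(1) \<open>0 < r\<close> by (simp add: field_simps)
    finally show ?thesis using bound by (simp only: mult.commute)
  qed
  with bound show ?case by blast
next
  case (2 gc uc)
  then show ?case using main_cost_bound_main_run by blast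
qed

end
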